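(* Let $\rightsquigarrow$ be a semi-1-eternal relation, $G$ a finite group, $p$ a prime divisor of $|G|$, and $S$ a Sylow $p$-subgroup of $G$. Suppose that every subgroup $H$ of $S$ of order $p$ satisfies $H\rightsquigarrow G$ and, if $S$ is non-abelian and $p=2$, every cyclic subgroup $H$ of $S$ of order $4$ satisfies $H\rightsquigarrow G$. Then $\mathcal{F}_S(G)$ is supersolvable.
   Context: All groups are finite. $Z_{\mathfrak{U}}(G)$ denotes the supersolvable hypercenter of $G$: the largest normal subgroup $N$ of $G$ such that every chief factor of $G$ below $N$ is cyclic (of prime order). Let $\rightsquigarrow$ be a relation, defined for every finite group $G$, between subgroups $H\le G$ and $G$ (written $H\rightsquigarrow G$). It is called semi-1-eternal if for every finite group $G$ the following hold: (0) for all subgroups $H\le K\le G$, if $H\rightsquigarrow G$ then $H\rightsquigarrow K$; (1') for every prime divisor $p$ of $|G|$: if every subgroup $H$ of $O_p(G)$ of order $p$ satisfies $H\rightsquigarrow G$ and, in case $O_p(G)$ is non-abelian and $p=2$, every cyclic subgroup $H$ of $O_p(G)$ of order $4$ satisfies $H\rightsquigarrow G$, then $O_p(G)\le Z_{\mathfrak{U}}(G)$. $\mathcal{F}_S(G)$ is the (saturated) fusion system on $S\in\mathrm{Syl}_p(G)$ whose objects are the subgroups of $S$ and whose morphisms $P\to Q$ are the maps $x\mapsto x^g$ with $g\in G$, $P^g\le Q$. A saturated fusion system $\mathcal{F}$ on a $p$-group $S$ is supersolvable if there is a series $1=S_0\le S_1\le\cdots\le S_n=S$ of strongly $\mathcal{F}$-closed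 subgroups of $S$ with $S_{i+1}/S_i$ cyclic for $0\le i\le n-1$. (A subgroup $T\le S$ is strongly $\mathcal{F}$-closed if for every $P\le T$ and every $\phi\in\mathrm{Hom}_{\mathcal{F}}(P,S)$ one has $P^{\phi}\le T$.) *)

theory Defs
  imports "HOL-Algebra.Elementary_Groups" "HOL-Computational_Algebra.Primes"
begin

definition sylow_subgroup :: "nat \<Rightarrow> ('a, 'b) monoid_scheme \<Rightarrow> 'a set \<Rightarrow> bool" where
  "sylow_subgroup p G S \<longleftrightarrow> subgroup S G \<and> card S = p ^ multiplicity p (order G)"

text \<open>
  For finite groups the greatest elements in the next definition and in that of the supersolvable
  hypercenter exist, because the respective families of normal subgroups contain the trivial
  subgroup and are closed under products.
\<close>

definition p_core :: "nat \<Rightarrow> ('a, 'b) monoid_scheme \<Rightarrow> 'a set" where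
  "p_core p G = (GREATEST N. normal N G \<and> (\<exists>n. card N = p ^ n))"

definition chief_factor :: "('a, 'b) monoid_scheme \<Rightarrow> 'a set \<Rightarrow> 'a set \<Rightarrow> bool" where
  "chief_factor G H K \<longleftrightarrow>
     normal H G \<and> normal K G \<and> K \<subset> H \<and> (\<nexists>L. normal L G \<and> K \<subset> L \<and> L \<subset> H)"

text \<open>A cyclic chief factor of a finite group automatically has prime order.\<close>

definition supersolvable_hypercenter :: "('a, 'b) monoid_scheme \<Rightarrow> 'a set" where
  "supersolvable_hypercenter G = (GREATEST N. normal N G \<and>
     (\<forall>H K. chief_factor G H K \<and> H \<subseteq> N \<longrightarrow> cyclic_group (G\<lparr>carrier := H\<rparr> Mod K)))"

text \<open>
  A relation between subgroups and groups is a predicate \<open>R H G\<close>. HOL cannot quantify over types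
  inside a formula, so ``every finite group'' means every finite group with elements in the
  type \<open>'a\<close>; for infinite \<open>'a\<close> these are all finite groups up to isomorphism. The restriction to
  \<open>'a\<close> of a relation that is semi-1-eternal on the class of all finite groups satisfies this
  predicate. No isomorphism invariance of \<open>R\<close> is required.
\<close>

definition semi_1_eternal :: "('a set \<Rightarrow> 'a monoid \<Rightarrow> bool) \<Rightarrow> bool" where
  "semi_1_eternal R \<longleftrightarrow>
    (\<forall>G. group G \<and> finite (carrier G) \<longrightarrow>
      (\<forall>H K. subgroup H G \<and> subgroup K G \<and> H \<subseteq> K \<and> R H G \<longrightarrow> R H (G\<lparr>carrier := K\<rparr>)) \<and>
      (\<forall>p. prime p \<and> p dvd order G \<and>
        (\<forall>H. subgroup H G \<and> H \<subseteq> p_core p G \<and> card H = p \<longrightarrow> R H G) \<and>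
        (\<not> comm_group (G\<lparr>carrier := p_core p G\<rparr>) \<and> p = 2 \<longrightarrow>
          (\<forall>H. subgroup H G \<and> H \<subseteq> p_core p G \<and> cyclic_group (G\<lparr>carrier := H\<rparr>) \<and> card H = 4
            \<longrightarrow> R H G))
        \<longrightarrow> p_core p G \<subseteq> supersolvable_hypercenter G))"

text \<open>
  A fusion system on a group \<open>S\<close> is given by its morphism sets: \<open>F P Q\<close> is the set of morphisms
  from \<open>P\<close> to \<open>Q\<close>, where the objects \<open>P\<close> and \<open>Q\<close> are the subgroups of \<open>S\<close>. Morphisms are
  restricted to their domain, so that equality of morphisms is equality of functions.
\<close>

type_synonym 'a fusion = "'a set \<Rightarrow> 'a set \<Rightarrow> ('a \<Rightarrow> 'a) set"

definition group_fusion :: "('a, 'b) monoid_scheme \<Rightarrow> 'a set \<Rightarrow> 'a fusion" where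
  "group_fusion G S P Q =
     {restrict (\<lambda>x. inv\<^bsub>G\<^esub> g \<otimes>\<^bsub>G\<^esub> x \<otimes>\<^bsub>G\<^esub> g) P | g.
        subgroup P (G\<lparr>carrier := S\<rparr>) \<and> subgroup Q (G\<lparr>carrier := S\<rparr>) \<and> g \<in> carrier G \<and>
        (\<lambda>x. inv\<^bsub>G\<^esub> g \<otimes>\<^bsub>G\<^esub> x \<otimes>\<^bsub>G\<^esub> g) ` P \<subseteq> Q}"

definition strongly_closed :: "('a, 'b) monoid_scheme \<Rightarrow> 'a fusion \<Rightarrow> 'a set \<Rightarrow> bool" where
  "strongly_closed S F T \<longleftrightarrow> subgroup T S \<and>
     (\<forall>P \<phi>. subgroup P S \<and> P \<subseteq> T \<and> \<phi> \<in> F P (carrier S) \<longrightarrow> \<phi> ` P \<subseteq> T)"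

text \<open>
  The quotients are meaningful as soon as \<open>F\<close> contains the conjugations by elements of \<open>S\<close>, as
  every fusion system on \<open>S\<close> does: strongly closed subgroups are then normal in \<open>S\<close>.
\<close>

definition supersolvable_fusion :: "('a, 'b) monoid_scheme \<Rightarrow> 'a fusion \<Rightarrow> bool" where
  "supersolvable_fusion S F \<longleftrightarrow>
     (\<exists>(n::nat) T. T 0 = {\<one>\<^bsub>S\<^esub>} \<and> T n = carrier S \<and>
        (\<forall>i\<le>n. strongly_closed S F (T i)) \<and>
        (\<forall>i<n. T i \<subseteq> T (Suc i) \<and> cyclic_group (S\<lparr>carrier := T (Suc i)\<rparr> Mod T i)))"

end

theory Submission
  imports Defs "HOL-Algebra.Sylow" "HOL-Algebra.Group_Action" "HOL-Algebra.Zassenhaus"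
    "HOL-Number_Theory.Residues"
begin

text \<open>
  If \<open>P \<le> S\<close> and \<open>N\<^sub>S(P)\<close> is a Sylow subgroup of \<open>K = N\<^sub>G(P)\<close>, then \<open>P \<le> O\<^sub>p(K) \<le> N\<^sub>S(P)\<close>,
  so the hypotheses are inherited by \<open>K\<close> and \<open>P\<close> lies in the supersolvable hypercenter of \<open>K\<close>.
  All \<open>p\<close>-elements of \<open>K\<close> then act trivially on the chief factors of \<open>K\<close> below \<open>P\<close>, and the
  group of elements acting in this way induces a \<open>p\<close>-group on \<open>P\<close>. Hence any two Sylow
  \<open>p\<close>-subgroups of \<open>K\<close> are conjugate under \<open>C\<^sub>K(P)\<close>. As in Alperin's fusion theorem it follows that
  fusion in \<open>S\<close> is controlled by \<open>N\<^sub>G(S)\<close>, and a chief series of \<open>N\<^sub>G(S)\<close> below \<open>S\<close>, whose factors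
  are cyclic by the case \<open>P = S\<close>, is the required series.
\<close>

section \<open>Fixed points and Sylow subgroups\<close>

text \<open>The obstacle is that (1') demands information about all of O_p(K), while the hypotheses
  only concern subgroups of S. They are usable in K = N_G(P) once O_p(K) is known to lie in S, which
  is what the Sylow condition on N_S(P) secures. For a given P this condition is not known
  beforehand. It is itself a consequence of control of fusion for larger subgroups: a Sylow subgroup
  of K containing a K-conjugate of N_S(P) can be conjugated into S, and on N_S(P) the composite map
  is induced by N_G(S), so it can be undone inside S. Both facts therefore live in one induction.
  Conjugacy under C_K(P), and not merely under K, makes the induction advance: multiplying g by a
  centralizing element leaves the map on P unchanged but lets it carry N_S(P) into S. Each map from
  a proper subgroup P of S into S thus extends to a strictly larger subgroup. The group acting
  trivially on the chief factors is a p-group on P because an element that is trivial on M and on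
  P/M sends y to q y with a fixed q in M, so its |M|-th power fixes y.\<close>

lemma (in group_action) card_fixed_points:
  assumes p: "prime p" and ord: "order G = p ^ k" and fin: "finite E"
  shows "p dvd card {x \<in> E. \<exists>g \<in> carrier G. \<phi> g x \<noteq> x}"
proof -
  define C where "C = {orb \<in> orbits G E \<phi>. card orb \<noteq> 1}"
  have part: "\<And>x. x \<in> E \<Longrightarrow> \<exists>!orb. orb \<in> orbits G E \<phi> \<and> x \<in> orb"
    "\<And>orb. orb \<in> orbits G E \<phi> \<Longrightarrow> orb \<subseteq> E"
    using orbit_partition unfolding Congruence.partition_def by auto
  have self: "x \<in> orbit G \<phi> x" if "x \<in> E" for x
    using orbit_refl that by auto
  have triv: "card (orbit G \<phi> x) = 1 \<longleftrightarrow> (\<forall>g \<in> carrier G. \<phi> g x = x)" if "x \<in> E" for x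
  proof
    assume "card (orbit G \<phi> x) = 1"
    then have "orbit G \<phi> x = {x}"
      using self[OF that] by (metis card_1_singletonE singletonD)
    then show "\<forall>g \<in> carrier G. \<phi> g x = x"
      unfolding orbit_def by auto
  next
    assume "\<forall>g \<in> carrier G. \<phi> g x = x"
    then have "orbit G \<phi> x = {x}"
      using self[OF that] unfolding orbit_def by auto
    then show "card (orbit G \<phi> x) = 1" by simp
  qed
  \<comment> \<open>The moved points form the union of the orbits with more than one point, and the
    length of such an orbit is a power of \<open>p\<close> other than 1. Counting moved instead of
    fixed points turns the usual congruence into a divisibility.\<close>
  have "{x \<in> E. \<exists>g \<in> carrier G. \<phi> g x \<noteq> x} = \<Union>C"
  proof (intro equalityI subsetI)
    fix x assume "x \<in> {x \<in> E. \<exists>g \<in> carrier G. \<phi> g x \<noteq> x}"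
    then have x: "x \<in> E" "card (orbit G \<phi> x) \<noteq> 1" using triv by auto
    then have "orbit G \<phi> x \<in> C" unfolding C_def orbits_def by auto
    then show "x \<in> \<Union>C" using self[OF x(1)] by auto
  next
    fix x assume "x \<in> \<Union>C"
    then obtain orb where orb: "orb \<in> orbits G E \<phi>" "card orb \<noteq> 1" "x \<in> orb"
      unfolding C_def by auto
    then have x: "x \<in> E" using part(2) by auto
    have "orbit G \<phi> x \<in> orbits G E \<phi>" using x unfolding orbits_def by auto
    then have "orbit G \<phi> x = orb" using part(1)[OF x] orb self[OF x] by auto
    then show "x \<in> {x \<in> E. \<exists>g \<in> carrier G. \<phi> g x \<noteq> x}"
      using orb x triv by auto
  qed
  moreover have "p dvd card (\<Union>C)"
  proof (rule dvd_partition)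
    show "finite (\<Union>C)"
      using fin part(2) by (auto simp: C_def intro: finite_subset)
    show "\<forall>c\<in>C. p dvd card c"
    proof
      fix c assume c: "c \<in> C"
      then obtain x where x: "x \<in> E" "c = orbit G \<phi> x" unfolding C_def orbits_def by auto
      have "card c dvd p ^ k"
        using orbit_stabilizer_theorem[OF x(1)] x(2) ord by (metis dvd_triv_left)
      then obtain j where j: "card c = p ^ j" using p divides_primepow_nat by auto
      then have "j \<noteq> 0" using c unfolding C_def by (metis (mono_tags) mem_Collect_eq power_0)
      then show "p dvd card c" using j by (simp add: dvd_power)
    qed
    show "\<forall>c1\<in>C. \<forall>c2\<in>C. c1 \<noteq> c2 \<longrightarrow> c1 \<inter> c2 = {}"
      using part unfolding C_def by blast
  qed
  ultimately show ?thesis by simp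
qed

context group
begin

lemma rcosets_mult_closed:
  assumes "subgroup H G" "X \<in> rcosets H" "g \<in> carrier G"
  shows "X #> g \<in> rcosets H"
  using assms by (auto simp: RCOSETS_def coset_mult_assoc subgroup.subset)

text \<open>Right multiplication reverses products; the inverse restores the order, as a
  homomorphism into \<open>BijGroup\<close> requires.\<close>

lemma rcosets_action:
  assumes H: "subgroup H G" and U: "subgroup U G"
  shows "group_action (G\<lparr>carrier := U\<rparr>) (rcosets H) (\<lambda>u. \<lambda>X\<in>rcosets H. X #> inv u)"
proof -
  interpret U: group "G\<lparr>carrier := U\<rparr>" using U by (rule subgroup_imp_group)
  have sub: "X \<subseteq> carrier G" if "X \<in> rcosets H" for X
    using that H rcosets_part_G by blast
  have mem: "u \<in> carrier G" if "u \<in> U" for u using U that by (rule subgroup.mem_carrier)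
  have bij: "(\<lambda>X\<in>rcosets H. X #> inv u) \<in> Bij (rcosets H)" if "u \<in> U" for u
    unfolding Bij_def
  proof (intro IntI CollectI)
    show "bij_betw (\<lambda>X\<in>rcosets H. X #> inv u) (rcosets H) (rcosets H)"
      by (rule bij_betwI[where g = "\<lambda>X. X #> u"])
        (use that mem H in \<open>auto simp: rcosets_mult_closed coset_mult_assoc sub\<close>)
  qed auto
  show ?thesis
    unfolding group_action_def
  proof (rule group_hom.intro[OF U.is_group group_BijGroup], unfold group_hom_axioms_def, rule homI)
    fix u assume "u \<in> carrier (G\<lparr>carrier := U\<rparr>)"
    then show "(\<lambda>X\<in>rcosets H. X #> inv u) \<in> carrier (BijGroup (rcosets H))"
      using bij by (simp add: BijGroup_def)
  next
    fix u v assume "u \<in> carrier (G\<lparr>carrier := U\<rparr>)" "v \<in> carrier (G\<lparr>carrier := U\<rparr>)"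
    then have uv: "u \<in> U" "v \<in> U" by auto
    then show "(\<lambda>X\<in>rcosets H. X #> inv (u \<otimes>\<^bsub>G\<lparr>carrier := U\<rparr>\<^esub> v)) =
      (\<lambda>X\<in>rcosets H. X #> inv u) \<otimes>\<^bsub>BijGroup (rcosets H)\<^esub> (\<lambda>X\<in>rcosets H. X #> inv v)"
      using bij[OF uv(1)] bij[OF uv(2)] mem H
      by (auto simp: BijGroup_def compose_def rcosets_mult_closed coset_mult_assoc sub
        inv_mult_group intro!: restrict_ext)
  qed
qed

text \<open>A coset \<open>H #> g\<close> is fixed by right multiplication with \<open>U\<close> iff \<open>g u g\<^sup>-\<^sup>1 \<in> H\<close> for all \<open>u \<in> U\<close>.\<close>

lemma card_cosets_not_conj_into:
  assumes fin: "finite (carrier G)" and H: "subgroup H G" and U: "subgroup U G"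
    and p: "prime p" and card: "card U = p ^ k"
  shows "p dvd card {X \<in> rcosets H. \<not> (\<exists>g \<in> carrier G. X = H #> g \<and> (\<forall>u \<in> U. g \<otimes> u \<otimes> inv g \<in> H))}"
proof -
  interpret act: group_action "G\<lparr>carrier := U\<rparr>" "rcosets H" "\<lambda>u. \<lambda>X\<in>rcosets H. X #> inv u"
    using rcosets_action[OF H U] .
  have mem: "u \<in> carrier G" if "u \<in> U" for u using U that by (rule subgroup.mem_carrier)
  have finH: "finite (rcosets H)"
    using fin by (auto simp: RCOSETS_def)
  have fixed: "H #> g #> inv u = H #> g \<longleftrightarrow> g \<otimes> u \<otimes> inv g \<in> H" if g: "g \<in> carrier G" and u: "u \<in> U" for g u
  proof -
    have u': "u \<in> carrier G" using mem u by auto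
    have "H #> g #> inv u = H #> (g \<otimes> inv u)"
      using g u' H by (simp add: coset_mult_assoc subgroup.subset)
    also have "\<dots> = H #> g \<longleftrightarrow> g \<otimes> inv (g \<otimes> inv u) \<in> H"
    proof
      assume eq: "H #> (g \<otimes> inv u) = H #> g"
      have "g \<in> H #> g" using g H by (simp add: rcos_self)
      then have "g \<in> H #> (g \<otimes> inv u)" using eq by simp
      then show "g \<otimes> inv (g \<otimes> inv u) \<in> H"
        using subgroup.rcos_module_imp[OF H is_group] g u' by auto
    next
      assume "g \<otimes> inv (g \<otimes> inv u) \<in> H"
      then have "g \<in> H #> (g \<otimes> inv u)"
        using subgroup.rcos_module_rev[OF H is_group] g u' by auto
      then show "H #> (g \<otimes> inv u) = H #> g"
        using repr_independence[OF _ _ H] g u' by auto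
    qed
    finally show ?thesis using g u' by (simp add: inv_mult_group m_assoc)
  qed
  have "{X \<in> rcosets H. \<exists>u \<in> carrier (G\<lparr>carrier := U\<rparr>). (\<lambda>X\<in>rcosets H. X #> inv u) X \<noteq> X}
    = {X \<in> rcosets H. \<not> (\<exists>g \<in> carrier G. X = H #> g \<and> (\<forall>u \<in> U. g \<otimes> u \<otimes> inv g \<in> H))}"
    (is "?L = ?R")
  proof (intro Collect_cong conj_cong refl)
    fix X assume X: "X \<in> rcosets H"
    then obtain g where g: "g \<in> carrier G" "X = H #> g" unfolding RCOSETS_def by auto
    show "(\<exists>u \<in> carrier (G\<lparr>carrier := U\<rparr>). (\<lambda>X\<in>rcosets H. X #> inv u) X \<noteq> X) =
      (\<not> (\<exists>g \<in> carrier G. X = H #> g \<and> (\<forall>u \<in> U. g \<otimes> u \<otimes> inv g \<in> H)))"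
    proof -
      have "(\<forall>u \<in> U. X #> inv u = X) \<longleftrightarrow> (\<forall>u \<in> U. h \<otimes> u \<otimes> inv h \<in> H)"
        if "h \<in> carrier G" "X = H #> h" for h
        using that fixed by simp
      then have "(\<exists>u \<in> U. X #> inv u \<noteq> X) \<longleftrightarrow>
          \<not> (\<exists>g \<in> carrier G. X = H #> g \<and> (\<forall>u \<in> U. g \<otimes> u \<otimes> inv g \<in> H))"
        using g by metis
      then show ?thesis using X by simp
    qed
  qed
  then show ?thesis
    using act.card_fixed_points[OF p _ finH, of k] card by (simp add: order_def)
qed

text \<open>Sylow's second theorem: the number of cosets moved by \<open>U\<close> is divisible by
  \<open>p\<close> and the index is not, so some coset is fixed.\<close>

lemma p_subgroup_conj_into:
  assumes fin: "finite (carrier G)" and H: "subgroup H G" and U: "subgroup U G"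
    and p: "prime p" and card: "card U = p ^ k" and index: "\<not> p dvd card (rcosets H)"
  obtains g where "g \<in> carrier G" "\<And>u. u \<in> U \<Longrightarrow> inv g \<otimes> u \<otimes> g \<in> H"
proof -
  let ?N = "{X \<in> rcosets H. \<not> (\<exists>g \<in> carrier G. X = H #> g \<and> (\<forall>u \<in> U. g \<otimes> u \<otimes> inv g \<in> H))}"
  have "?N \<noteq> rcosets H"
    using card_cosets_not_conj_into[OF fin H U p card] index by auto
  then obtain g where g: "g \<in> carrier G" "\<forall>u \<in> U. g \<otimes> u \<otimes> inv g \<in> H" by blast
  then show thesis using that[of "inv g"] by auto
qed

text \<open>Let \<open>U\<close> act on its own cosets. Both the index and the number of moved
  cosets are divisible by \<open>p\<close>, hence so is the number of fixed ones. The coset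
  \<open>U\<close> is fixed, so there is a second fixed coset, and its representatives normalize
  \<open>U\<close>.\<close>

lemma proper_p_subgroup_normalized:
  assumes fin: "finite (carrier G)" and U: "subgroup U G" "U \<noteq> carrier G"
    and p: "prime p" and card: "order G = p ^ k"
  obtains g where "g \<in> carrier G" "g \<notin> U" "\<And>u. u \<in> U \<Longrightarrow> inv g \<otimes> u \<otimes> g \<in> U"
proof -
  let ?N = "{X \<in> rcosets U. \<not> (\<exists>g \<in> carrier G. X = U #> g \<and> (\<forall>u \<in> U. g \<otimes> u \<otimes> inv g \<in> U))}"
  have lag: "card (rcosets U) * card U = p ^ k" using lagrange[OF U(1)] card by simp
  have "card U dvd p ^ k" using lag by (metis dvd_triv_right)
  then obtain j where j: "card U = p ^ j" using p divides_primepow_nat by auto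
  have "card (rcosets U) \<noteq> 1"
  proof
    assume "card (rcosets U) = 1"
    then have "card U = card (carrier G)" using lag card by (simp add: order_def)
    then show False using U fin by (metis card_subset_eq subgroup.subset)
  qed
  moreover obtain i where i: "card (rcosets U) = p ^ i"
    using lag p divides_primepow_nat by (metis dvd_triv_left)
  ultimately have "p dvd card (rcosets U)" by (cases i) auto
  moreover have "p dvd card ?N" using card_cosets_not_conj_into[OF fin U(1) U(1) p j] .
  moreover have finU: "finite (rcosets U)" using fin by (auto simp: RCOSETS_def)
  ultimately have dvd: "p dvd card (rcosets U - ?N)"
    by (subst card_Diff_subset) (auto intro: finite_subset)
  have "U #> \<one> = U" using U by (simp add: coset_mult_one subgroup.subset)
  have "U \<in> rcosets U - ?N"
  proof -
    have "U #> \<one> \<in> rcosets U" unfolding RCOSETS_def by auto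
    moreover have "\<forall>u \<in> U. \<one> \<otimes> u \<otimes> inv \<one> \<in> U"
      using U(1) by (simp add: subgroup.mem_carrier)
    then have "U \<notin> ?N"
      using \<open>U #> \<one> = U\<close> one_closed by blast
    ultimately show ?thesis using \<open>U #> \<one> = U\<close> by auto
  qed
  moreover have "rcosets U - ?N \<noteq> {U}" using dvd p by (auto simp: prime_nat_iff)
  ultimately obtain X where X: "X \<in> rcosets U - ?N" "X \<noteq> U" by blast
  then obtain g where g: "g \<in> carrier G" "X = U #> g" "\<forall>u \<in> U. g \<otimes> u \<otimes> inv g \<in> U" by auto
  have "g \<notin> U" using X(2) g(2) U(1) by (metis coset_join2 g(1))
  then have "inv g \<notin> U" using U(1) g(1) by (metis inv_inv subgroup.m_inv_closed)
  then show thesis using that[of "inv g"] g by auto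
qed

section \<open>The supersolvable hypercenter and the p-core\<close>


lemma inv_mult_cancel:
  assumes "x \<in> carrier G" "y \<in> carrier G"
  shows "inv x \<otimes> (x \<otimes> y) = y" "x \<otimes> (inv x \<otimes> y) = y"
  using assms m_assoc[of "inv x" x y] m_assoc[of x "inv x" y] by simp_all

lemma subset_set_mult:
  assumes "subgroup A G" "subgroup B G"
  shows "A \<subseteq> A <#> B" "B \<subseteq> A <#> B"
proof -
  show "A \<subseteq> A <#> B"
  proof
    fix a assume a: "a \<in> A"
    then have "a = a \<otimes> \<one>" using assms by (simp add: subgroup.mem_carrier)
    then show "a \<in> A <#> B" using a assms subgroup.one_closed unfolding set_mult_def by blast
  qed
  show "B \<subseteq> A <#> B"
  proof
    fix a assume a: "a \<in> B"
    then have "a = \<one> \<otimes> a" using assms by (simp add: subgroup.mem_carrier)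
    then show "a \<in> A <#> B" using a assms subgroup.one_closed unfolding set_mult_def by blast
  qed
qed

lemma set_mult_subset:
  assumes "subgroup L G" "A \<subseteq> L" "B \<subseteq> L"
  shows "A <#> B \<subseteq> L"
  using assms(2,3) by (auto simp: set_mult_def intro!: subgroup.m_closed[OF assms(1)])

lemma normal_set_mult:
  assumes A: "A \<lhd> G" and B: "B \<lhd> G"
  shows "A <#> B \<lhd> G"
proof (rule normal_invI)
  show "subgroup (A <#> B) G" using mult_norm_subgroup[OF A normal_imp_subgroup[OF B]] .
  fix x y assume x: "x \<in> carrier G" and "y \<in> A <#> B"
  then obtain a b where ab: "a \<in> A" "b \<in> B" "y = a \<otimes> b" unfolding set_mult_def by auto
  have "a \<in> carrier G" "b \<in> carrier G"
    using ab A B by (auto intro: subgroup.mem_carrier normal_imp_subgroup)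
  then have "x \<otimes> y \<otimes> inv x = (x \<otimes> a \<otimes> inv x) \<otimes> (x \<otimes> b \<otimes> inv x)"
    using x ab by (simp add: m_assoc inv_mult_cancel)
  moreover have "x \<otimes> a \<otimes> inv x \<in> A" "x \<otimes> b \<otimes> inv x \<in> B"
    using ab x A B by (auto intro: normal.inv_op_closed2)
  ultimately show "x \<otimes> y \<otimes> inv x \<in> A <#> B" unfolding set_mult_def by auto
qed

text \<open>A normal \<open>L\<close> strictly between \<open>K\<close> and \<open>K <#> H\<close>
  meets \<open>H\<close> in \<open>K \<inter> H\<close> or in \<open>H\<close>, as nothing normal
  lies between these. By the modular law the first case gives L = K, and the second gives L =
  KH.\<close>

lemma chief_factor_lift:
  assumes K: "K \<lhd> G" and H: "H \<lhd> G" and chief: "chief_factor G H (K \<inter> H)"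
  shows "chief_factor G (K <#> H) K"
proof -
  have s: "subgroup K G" "subgroup H G" using K H normal_imp_subgroup by auto
  note sub = subset_set_mult[OF s]
  have "K \<subset> K <#> H"
    using sub chief unfolding chief_factor_def by auto
  moreover have False if L: "L \<lhd> G" "K \<subset> L" "L \<subset> K <#> H" for L
  proof -
    have sL: "subgroup L G" using L normal_imp_subgroup by auto
    have "L \<inter> H \<lhd> G" using normal_subgroup_intersect L H by auto
    moreover have "K \<inter> H \<subseteq> L \<inter> H" using L by auto
    ultimately consider "L \<inter> H = K \<inter> H" | "L \<inter> H = H"
      using chief unfolding chief_factor_def by blast
    then show False
    proof cases
      case 1
      have "L \<subseteq> K"
      proof
        fix x assume x: "x \<in> L"
        then obtain k h where kh: "k \<in> K" "h \<in> H" "x = k \<otimes> h" using L(3) unfolding set_mult_def by blast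
        then have c: "k \<in> carrier G" "h \<in> carrier G" using s by (auto intro: subgroup.mem_carrier)
        have "h = inv k \<otimes> x" using kh c by (simp add: inv_solve_left)
        moreover have "inv k \<otimes> x \<in> L" using kh L(2) x sL s
          by (meson psubsetD subgroup.m_closed subgroup.m_inv_closed)
        ultimately have "h \<in> K" using 1 kh by auto
        then show "x \<in> K" using kh s by (simp add: subgroup.m_closed)
      qed
      then show False using L by auto
    next
      case 2
      then have "K <#> H \<subseteq> L" using set_mult_subset[OF sL, of K H] L(2) by blast
      then show False using L by auto
    qed
  qed
  ultimately show ?thesis
    using K normal_set_mult[OF K H] unfolding chief_factor_def by blast
qed

text \<open>The converse passage: a normal \<open>L\<close> strictly between
  \<open>K \<inter> H\<close> and \<open>H\<close> would give a product \<open>K <#> L\<close> equal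
  to \<open>K\<close> or to \<open>K <#> H\<close>, and the modular law excludes both.\<close>

lemma chief_factor_restrict:
  assumes H: "H \<lhd> G" and chief: "chief_factor G (K <#> H) K"
  shows "chief_factor G H (K \<inter> H)"
proof -
  have K: "K \<lhd> G" using chief unfolding chief_factor_def by auto
  have s: "subgroup K G" "subgroup H G" using K H normal_imp_subgroup by auto
  have "\<not> H \<subseteq> K"
    using chief set_mult_subset[OF s(1)] unfolding chief_factor_def by auto
  then have "K \<inter> H \<subset> H" by auto
  moreover have False if L: "L \<lhd> G" "K \<inter> H \<subset> L" "L \<subset> H" for L
  proof -
    have sL: "subgroup L G" using L normal_imp_subgroup by auto
    note sub = subset_set_mult[OF s(1) sL]
    have "K <#> L \<lhd> G" using normal_set_mult K L by auto
    moreover have "K <#> L \<subseteq> K <#> H" using L unfolding set_mult_def by auto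
    ultimately consider "K <#> L = K" | "K <#> L = K <#> H"
      using chief sub unfolding chief_factor_def by blast
    then show False
    proof cases
      case 1
      then show False using sub L by auto
    next
      case 2
      have "H \<subseteq> L"
      proof
        fix x assume x: "x \<in> H"
        then have "x \<in> K <#> L" using 2 subset_set_mult[OF s] by auto
        then obtain k l where kl: "k \<in> K" "l \<in> L" "x = k \<otimes> l" unfolding set_mult_def by auto
        then have c: "k \<in> carrier G" "l \<in> carrier G" using s sL by (auto intro: subgroup.mem_carrier)
        have "k = x \<otimes> inv l" using kl c by (simp add: inv_solve_right)
        moreover have "x \<otimes> inv l \<in> H" using kl L(3) x s
          by (meson psubsetD subgroup.m_closed subgroup.m_inv_closed)
        ultimately have "k \<in> L" using kl L by auto
        then show "x \<in> L" using kl sL by (simp add: subgroup.m_closed)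
      qed
      then show False using L by auto
    qed
  qed
  ultimately show ?thesis
    using H normal_subgroup_intersect[OF K H] unfolding chief_factor_def by blast
qed

lemma cyclic_set_mult_Mod:
  assumes K: "K \<lhd> G" and H: "subgroup H G"
  shows "cyclic_group (G\<lparr>carrier := K <#> H\<rparr> Mod K) \<longleftrightarrow> cyclic_group (G\<lparr>carrier := H\<rparr> Mod (K \<inter> H))"
  by (rule isomorphic_group_cyclicity[OF weak_snd_iso_thme[OF H K]])
    (auto intro!: normal.factorgroup_is_group normal_in_normal_set_mult normal_Int_subgroup K H)

text \<open>The property maximized by \<open>supersolvable_hypercenter\<close>. It is isolated
  because, unlike being the greatest such subgroup, it passes to smaller normal subgroups, on which
  the later inductions run.\<close>

definition supersolvably_embedded :: "'a set \<Rightarrow> bool" where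
  "supersolvably_embedded N \<longleftrightarrow> N \<lhd> G \<and>
     (\<forall>H K. chief_factor G H K \<and> H \<subseteq> N \<longrightarrow> cyclic_group (G\<lparr>carrier := H\<rparr> Mod K))"

lemma supersolvably_embedded_normal: "supersolvably_embedded N \<Longrightarrow> N \<lhd> G"
  unfolding supersolvably_embedded_def by simp

text \<open>Every chief factor H/K below AB is isomorphic to a chief factor below A or below B. If
  \<open>H \<inter> A\<close> is not inside K, it covers H/K; otherwise H/K survives modulo A, where
  B covers it.\<close>

lemma supersolvably_embedded_set_mult:
  assumes A: "supersolvably_embedded A" and B: "supersolvably_embedded B"
  shows "supersolvably_embedded (A <#> B)"
  unfolding supersolvably_embedded_def
proof (intro conjI allI impI, goal_cases)
  case 1
  then show ?case using A B normal_set_mult unfolding supersolvably_embedded_def by auto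
next
  case (2 H K)
  then have chief: "chief_factor G H K" and HAB: "H \<subseteq> A <#> B" by auto
  have n: "A \<lhd> G" "B \<lhd> G" "H \<lhd> G" "K \<lhd> G" and KH: "K \<subseteq> H"
    using A B chief unfolding supersolvably_embedded_def chief_factor_def by auto
  note s = n[THEN normal_imp_subgroup]
  have nHA: "H \<inter> A \<lhd> G" using normal_subgroup_intersect n by auto
  note sHA = normal_imp_subgroup[OF nHA]
  show ?case
  proof (cases "H \<inter> A \<subseteq> K")
    case False
    have "K <#> (H \<inter> A) \<lhd> G" using normal_set_mult n nHA by auto
    moreover have "K <#> (H \<inter> A) \<subseteq> H" using set_mult_subset[OF s(3)] KH by auto
    moreover have "K \<subset> K <#> (H \<inter> A)" using subset_set_mult[OF s(4) sHA] False by auto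
    ultimately have eq: "H = K <#> (H \<inter> A)" using chief unfolding chief_factor_def by blast
    then have "chief_factor G (H \<inter> A) (K \<inter> (H \<inter> A))"
      using chief_factor_restrict[OF nHA] chief by simp
    then have "cyclic_group (G\<lparr>carrier := H \<inter> A\<rparr> Mod (K \<inter> (H \<inter> A)))"
      using A unfolding supersolvably_embedded_def by auto
    then show ?thesis using cyclic_set_mult_Mod[OF n(4) sHA] eq by simp
  next
    case True
    \<comment> \<open>Since \<open>H \<inter> A\<close> lies in K, the modular law gives
      \<open>M \<inter> H = K\<close>; so H/K can be replaced by the factor MH/M lying above
      A.\<close>
    define M where "M = A <#> K"
    have nM: "M \<lhd> G" using normal_set_mult n M_def by auto
    note sM = normal_imp_subgroup[OF nM]
    have AM: "A \<subseteq> M" "K \<subseteq> M" using subset_set_mult[OF s(1,4)] M_def by auto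
    have "M \<inter> H \<subseteq> K"
    proof
      fix x assume x: "x \<in> M \<inter> H"
      then obtain a k where ak: "a \<in> A" "k \<in> K" "x = a \<otimes> k" unfolding M_def set_mult_def by auto
      then have c: "a \<in> carrier G" "k \<in> carrier G" using s by (auto intro: subgroup.mem_carrier)
      have "a = x \<otimes> inv k" using ak c by (simp add: inv_solve_right)
      moreover have "x \<otimes> inv k \<in> H" using ak KH x s
        by (metis IntD2 subgroup.m_closed subgroup.m_inv_closed subsetD)
      ultimately have "a \<in> K" using True ak by auto
      then show "x \<in> K" using ak s by (simp add: subgroup.m_closed)
    qed
    then have MH: "M \<inter> H = K" using AM KH by auto
    then have "chief_factor G (M <#> H) M" using chief_factor_lift[OF nM n(3)] chief by simp
    \<comment> \<open>\<open>C\<close> is the part of B that covers MH/M: writing h = a b, the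
      element a belongs to M, so b alone represents h modulo M.\<close>
    define C where "C = (M <#> H) \<inter> B"
    have nC: "C \<lhd> G" using normal_subgroup_intersect normal_set_mult nM n C_def by auto
    note sC = normal_imp_subgroup[OF nC]
    have sMH: "subgroup (M <#> H) G" using normal_imp_subgroup normal_set_mult nM n by auto
    have "M <#> H \<subseteq> M <#> C"
    proof
      fix x assume x: "x \<in> M <#> H"
      then obtain m h where mh: "m \<in> M" "h \<in> H" "x = m \<otimes> h" unfolding set_mult_def by auto
      then obtain a b where ab: "a \<in> A" "b \<in> B" "h = a \<otimes> b" using HAB unfolding set_mult_def by blast
      have c: "m \<in> carrier G" "h \<in> carrier G" "a \<in> carrier G" "b \<in> carrier G"
        using mh ab s sM by (auto intro: subgroup.mem_carrier)
      have "b = inv a \<otimes> h" using ab c by (simp add: inv_solve_left)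
      moreover have "inv a \<in> M" using ab AM sM by (auto intro: subgroup.m_inv_closed)
      ultimately have "b \<in> M <#> H" using mh unfolding set_mult_def by blast
      then have "b \<in> C" using ab C_def by auto
      moreover have "m \<otimes> a \<in> M" using mh ab AM sM by (auto intro: subgroup.m_closed)
      moreover have "x = (m \<otimes> a) \<otimes> b" using mh ab c by (simp add: m_assoc)
      ultimately show "x \<in> M <#> C" unfolding set_mult_def by blast
    qed
    moreover have "M <#> C \<subseteq> M <#> H"
      using set_mult_subset[OF sMH, of M C] subset_set_mult[OF sM s(3)] C_def by auto
    ultimately have eq: "M <#> H = M <#> C" by auto
    then have "chief_factor G C (M \<inter> C)"
      using chief_factor_restrict[OF nC] \<open>chief_factor G (M <#> H) M\<close> by simp
    then have "cyclic_group (G\<lparr>carrier := C\<rparr> Mod (M \<inter> C))"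
      using B C_def unfolding supersolvably_embedded_def by auto
    then have "cyclic_group (G\<lparr>carrier := M <#> H\<rparr> Mod M)"
      using cyclic_set_mult_Mod[OF nM sC] eq by simp
    then show ?thesis using cyclic_set_mult_Mod[OF nM s(3)] MH by simp
  qed
qed

text \<open>\<open>Greatest\<close> refers to inclusion, where a maximal element need not be
  greatest. A member of maximal cardinality equals its product with any other member and hence
  contains that member.\<close>

lemma Greatest_set_mult_closed:
  assumes fin: "finite (carrier G)" and sub: "\<And>A. Q A \<Longrightarrow> subgroup A G"
    and one: "Q {\<one>}" and mult: "\<And>A B. Q A \<Longrightarrow> Q B \<Longrightarrow> Q (A <#> B)"
  shows "Q (Greatest Q)" and "Q A \<Longrightarrow> A \<subseteq> Greatest Q"
proof -
  have "\<forall>A. Q A \<longrightarrow> card A \<le> order G"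
    using sub fin by (auto simp: order_def card_mono subgroup.subset)
  then obtain M where M: "Q M" "\<forall>A. Q A \<longrightarrow> card A \<le> card M"
    using ex_has_greatest_nat[of Q "{\<one>}" card "Suc (order G)"] one by (metis le_imp_less_Suc)
  have max: "A \<subseteq> M" if "Q A" for A
  proof -
    note s = subset_set_mult[OF sub[OF M(1)] sub[OF that]]
    have "finite (M <#> A)" using sub[OF mult[OF M(1) that]] fin finite_subset subgroup.subset by blast
    then have "M = M <#> A"
      using s(1) M mult[OF M(1) that] by (simp add: card_seteq)
    then show ?thesis using s by auto
  qed
  have "Greatest Q = M" using M(1) max by (intro Greatest_equality) auto
  then show "Q (Greatest Q)" "Q A \<Longrightarrow> A \<subseteq> Greatest Q" using M max by auto
qed

lemma trivial_normal: "{\<one>} \<lhd> G"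
  by (simp add: normal_inv_iff triv_subgroup)

lemma supersolvably_embedded_trivial: "supersolvably_embedded {\<one>}"
proof -
  have False if "chief_factor G H K" "H \<subseteq> {\<one>}" for H K
  proof -
    have "\<one> \<in> K" "K \<subset> H"
      using that(1) unfolding chief_factor_def
      by (auto intro: subgroup.one_closed normal_imp_subgroup)
    then show False using that(2) by auto
  qed
  then show ?thesis unfolding supersolvably_embedded_def using trivial_normal by auto
qed

lemma supersolvably_embedded_hypercenter:
  assumes fin: "finite (carrier G)"
  shows "supersolvably_embedded (supersolvable_hypercenter G)"
proof -
  have eq: "supersolvable_hypercenter G = Greatest supersolvably_embedded"
    unfolding supersolvable_hypercenter_def supersolvably_embedded_def ..
  show ?thesis
    unfolding eq
    by (rule Greatest_set_mult_closed(1)[OF fin])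
      (auto simp: supersolvably_embedded_trivial supersolvably_embedded_set_mult
        intro: normal_imp_subgroup supersolvably_embedded_normal)
qed

lemma supersolvably_embedded_mono:
  "supersolvably_embedded N \<Longrightarrow> M \<lhd> G \<Longrightarrow> M \<subseteq> N \<Longrightarrow> supersolvably_embedded M"
  unfolding supersolvably_embedded_def using subset_trans by metis

section \<open>Sylow subgroups and the p-core\<close>

lemma sylow_index:
  assumes "finite (carrier G)" "prime p" "sylow_subgroup p G S"
  shows "\<not> p dvd card (rcosets S)"
proof
  assume "p dvd card (rcosets S)"
  moreover have "card (rcosets S) * p ^ multiplicity p (order G) = order G"
    using assms lagrange unfolding sylow_subgroup_def by metis
  ultimately have "p * p ^ multiplicity p (order G) dvd order G"
    by (metis mult_dvd_mono dvd_refl)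
  then have "Suc (multiplicity p (order G)) \<le> multiplicity p (order G)"
    using assms by (intro multiplicity_geI) (auto simp: order_gt_0_iff_finite prime_nat_iff)
  then show False by simp
qed

lemma sylow_exists:
  assumes "finite (carrier G)" "prime p"
  obtains S where "sylow_subgroup p G S"
proof -
  obtain m where "order G = p ^ multiplicity p (order G) * m"
    using multiplicity_dvd by (metis dvdE)
  then show thesis using sylow_thm[OF assms(2) is_group _ assms(1)] that
    unfolding sylow_subgroup_def by blast
qed

text \<open>Some conjugate of \<open>N\<close> lies in \<open>S\<close>, and a normal subgroup is
  its own conjugate.\<close>

lemma normal_p_subgroup_subset_sylow:
  assumes fin: "finite (carrier G)" and p: "prime p" and S: "sylow_subgroup p G S"
    and N: "N \<lhd> G" and card: "card N = p ^ k"
  shows "N \<subseteq> S"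
proof
  fix x assume x: "x \<in> N"
  have sN: "subgroup N G" using N normal_imp_subgroup by auto
  obtain g where g: "g \<in> carrier G" "\<And>u. u \<in> N \<Longrightarrow> inv g \<otimes> u \<otimes> g \<in> S"
    using p_subgroup_conj_into[OF fin _ sN p card sylow_index[OF fin p S]] S
    unfolding sylow_subgroup_def by auto
  have xc: "x \<in> carrier G" using x sN by (auto intro: subgroup.mem_carrier)
  have "g \<otimes> x \<otimes> inv g \<in> N" using normal.inv_op_closed2[OF N g(1) x] .
  moreover have "inv g \<otimes> (g \<otimes> x \<otimes> inv g) \<otimes> g = x"
    using g(1) xc by (simp add: m_assoc inv_mult_cancel)
  ultimately show "x \<in> S" using g(2) by metis
qed

lemma p_subgroup_card:
  assumes "subgroup A G" "subgroup B G" "A \<subseteq> B" "card B = p ^ n" "prime (p::nat)"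
  obtains k where "card A = p ^ k"
proof -
  interpret B: group "G\<lparr>carrier := B\<rparr>" using assms by (simp add: subgroup_imp_group)
  have "card (rcosets\<^bsub>G\<lparr>carrier := B\<rparr>\<^esub> A) * card A = card B"
    using B.lagrange[OF subgroup_incl[OF assms(1,2,3)]] by (simp add: order_def)
  then have "card A dvd p ^ n" using assms(4) dvd_triv_right by metis
  then obtain k where "card A = p ^ k"
    using divides_primepow_nat[OF assms(5)] by auto
  then show thesis using that by blast
qed

lemma
  assumes fin: "finite (carrier G)" and p: "prime p"
  shows p_core_normal: "p_core p G \<lhd> G"
    and p_core_card: "\<exists>n. card (p_core p G) = p ^ n"
    and p_core_greatest: "N \<lhd> G \<Longrightarrow> card N = p ^ n \<Longrightarrow> N \<subseteq> p_core p G"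
proof -
  let ?Q = "\<lambda>N. N \<lhd> G \<and> (\<exists>n. card N = p ^ n)"
  have one: "?Q {\<one>}" using trivial_normal by (auto intro: exI[of _ 0])
  have mult: "?Q (A <#> B)" if A: "?Q A" and B: "?Q B" for A B
  proof -
    obtain S where S: "sylow_subgroup p G S" using sylow_exists[OF fin p] .
    then have sS: "subgroup S G" "card S = p ^ multiplicity p (order G)"
      unfolding sylow_subgroup_def by auto
    \<comment> \<open>A Sylow subgroup contains both factors and therefore their product, whose
      order is then a power of \<open>p\<close> by Lagrange's theorem.\<close>
    have "A <#> B \<subseteq> S"
      using normal_p_subgroup_subset_sylow[OF fin p S] A B by (intro set_mult_subset[OF sS(1)]) blast+
    moreover have n: "A <#> B \<lhd> G" using normal_set_mult A B by auto
    ultimately obtain k where "card (A <#> B) = p ^ k"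
      using p_subgroup_card[OF normal_imp_subgroup[OF n] sS(1) _ sS(2) p] by blast
    then show ?thesis using n by blast
  qed
  have sub: "subgroup A G" if "?Q A" for A using that normal_imp_subgroup by blast
  have eq: "p_core p G = Greatest ?Q" unfolding p_core_def ..
  have "?Q (p_core p G)"
    unfolding eq by (rule Greatest_set_mult_closed(1)[where Q = ?Q]) (fact fin sub one mult)+
  then show "p_core p G \<lhd> G" "\<exists>n. card (p_core p G) = p ^ n" by auto
  have "N \<subseteq> p_core p G" if "?Q N" for N
    unfolding eq by (rule Greatest_set_mult_closed(2)[where Q = ?Q]) (fact fin sub one mult that)+
  then show "N \<subseteq> p_core p G" if "N \<lhd> G" "card N = p ^ n" using that by blast
qed

end

section \<open>The action on a supersolvably embedded p-subgroup\<close>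

text \<open>The map x \<mapsto> x^g in the convention of \<open>group_fusion\<close>. It is a right
  action: conjugation by a product applies the left factor first.\<close>

definition conj_by :: "('a, 'b) monoid_scheme \<Rightarrow> 'a \<Rightarrow> 'a \<Rightarrow> 'a" where
  "conj_by G g x = inv\<^bsub>G\<^esub> g \<otimes>\<^bsub>G\<^esub> x \<otimes>\<^bsub>G\<^esub> g"

definition pointwise_centralizer :: "('a, 'b) monoid_scheme \<Rightarrow> 'a set \<Rightarrow> 'a set" where
  "pointwise_centralizer G P = {g \<in> carrier G. \<forall>x\<in>P. conj_by G g x = x}"

context group
begin

lemma conj_by_closed [simp, intro]:
  "g \<in> carrier G \<Longrightarrow> x \<in> carrier G \<Longrightarrow> conj_by G g x \<in> carrier G"
  unfolding conj_by_def by simp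

lemma conj_by_one [simp]: "x \<in> carrier G \<Longrightarrow> conj_by G \<one> x = x"
  unfolding conj_by_def by simp

lemma conj_by_comp:
  "g \<in> carrier G \<Longrightarrow> h \<in> carrier G \<Longrightarrow> x \<in> carrier G \<Longrightarrow>
    conj_by G (g \<otimes> h) x = conj_by G h (conj_by G g x)"
  unfolding conj_by_def by (simp add: m_assoc inv_mult_group)

lemma conj_by_mult:
  "g \<in> carrier G \<Longrightarrow> x \<in> carrier G \<Longrightarrow> y \<in> carrier G \<Longrightarrow>
    conj_by G g (x \<otimes> y) = conj_by G g x \<otimes> conj_by G g y"
  unfolding conj_by_def by (simp add: m_assoc inv_mult_cancel)

lemma conj_by_inv_cancel [simp]:
  assumes "g \<in> carrier G" "x \<in> carrier G"
  shows "conj_by G (inv g) (conj_by G g x) = x" "conj_by G g (conj_by G (inv g) x) = x"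
  using assms conj_by_comp[of g "inv g" x] conj_by_comp[of "inv g" g x] by simp_all

lemma conj_by_pow:
  assumes "g \<in> carrier G" "x \<in> carrier G"
  shows "conj_by G g (x [^] (n::nat)) = conj_by G g x [^] n"
  using assms by (induction n) (simp_all add: conj_by_mult, simp add: conj_by_def)

lemma conj_by_normal:
  "N \<lhd> G \<Longrightarrow> g \<in> carrier G \<Longrightarrow> x \<in> N \<Longrightarrow> conj_by G g x \<in> N"
  unfolding conj_by_def by (rule normal.inv_op_closed1)

lemma conj_by_subgroup:
  "subgroup N G \<Longrightarrow> g \<in> N \<Longrightarrow> x \<in> N \<Longrightarrow> conj_by G g x \<in> N"
  unfolding conj_by_def by (simp add: subgroup.m_closed subgroup.m_inv_closed)

lemma normal_conj_byI:
  assumes "subgroup N G" "\<And>g x. g \<in> carrier G \<Longrightarrow> x \<in> N \<Longrightarrow> conj_by G g x \<in> N"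
  shows "N \<lhd> G"
proof (rule normal_invI[OF assms(1)])
  fix x h assume "x \<in> carrier G" "h \<in> N"
  then show "x \<otimes> h \<otimes> inv x \<in> N" using assms(2)[of "inv x" h] unfolding conj_by_def by simp
qed

lemma conj_by_consistent:
  "subgroup K G \<Longrightarrow> g \<in> K \<Longrightarrow> conj_by (G\<lparr>carrier := K\<rparr>) g x = conj_by G g x"
  unfolding conj_by_def by (simp add: m_inv_consistent)

lemma pointwise_centralizer_normal:
  assumes P: "P \<lhd> G"
  shows "pointwise_centralizer G P \<lhd> G"
proof -
  have Pc: "P \<subseteq> carrier G" using P by (simp add: normal_imp_subgroup subgroup.subset)
  show ?thesis
  proof (intro normal_conj_byI subgroupI)
    show "pointwise_centralizer G P \<noteq> {}"
      using Pc by (auto simp: pointwise_centralizer_def intro!: exI[of _ \<one>])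
  next
    fix a assume "a \<in> pointwise_centralizer G P"
    then show "inv a \<in> pointwise_centralizer G P"
      using Pc conj_by_inv_cancel(1) unfolding pointwise_centralizer_def by (smt (verit, best) inv_closed mem_Collect_eq subsetD)
  next
    fix a b assume "a \<in> pointwise_centralizer G P" "b \<in> pointwise_centralizer G P"
    then show "a \<otimes> b \<in> pointwise_centralizer G P"
      using Pc conj_by_comp unfolding pointwise_centralizer_def by (auto simp: subset_iff)
  next
    fix g c assume g: "g \<in> carrier G" and c: "c \<in> pointwise_centralizer G P"
    then have cc: "c \<in> carrier G" unfolding pointwise_centralizer_def by auto
    have "conj_by G (conj_by G g c) x = x" if x: "x \<in> P" for x
    proof -
      have xc: "x \<in> carrier G" using x Pc by auto
      have "conj_by G (inv g) x \<in> P" using conj_by_normal[OF P] g x by auto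
      then have "conj_by G c (conj_by G (inv g) x) = conj_by G (inv g) x"
        using c unfolding pointwise_centralizer_def by auto
      then have "conj_by G g (conj_by G c (conj_by G (inv g) x)) = x" using g xc by simp
      moreover have "conj_by G (conj_by G g c) x = conj_by G g (conj_by G c (conj_by G (inv g) x))"
        using g cc xc by (simp add: conj_by_comp[symmetric]) (simp add: conj_by_def[of G g c])
      ultimately show ?thesis by simp
    qed
    then show "conj_by G g c \<in> pointwise_centralizer G P"
      using g cc unfolding pointwise_centralizer_def by auto
  qed (auto simp: pointwise_centralizer_def)
qed

lemma pow_cong_exponent:
  assumes v: "v \<in> carrier G" "v [^] (m::nat) = \<one>" and "[a = b] (mod m)"
  shows "v [^] (a::nat) = v [^] b"
proof -
  have "v [^] n = v [^] (n mod m)" for n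
  proof -
    have "v [^] n = v [^] (m * (n div m) + n mod m)" by simp
    also have "\<dots> = (v [^] m) [^] (n div m) \<otimes> v [^] (n mod m)"
      using v(1) by (simp only: nat_pow_mult[symmetric] nat_pow_pow)
    finally show ?thesis using v by simp
  qed
  then show ?thesis using assms(3) unfolding cong_def by metis
qed

text \<open>An automorphism of \<open>p\<close>-power order of a cyclic group of order \<open>p\<close> is trivial, by Fermat's little theorem.\<close>

lemma conj_by_p_element_fixes:
  fixes p :: nat
  assumes p: "prime p" and u: "u \<in> carrier G" "u [^] (p ^ k) = \<one>"
    and v: "v \<in> carrier G" "v [^] p = \<one>" and uv: "conj_by G u v = v [^] (a::nat)"
  shows "conj_by G u v = v"
proof -
  have "conj_by G (u [^] j) v = v [^] (a ^ j)" for j :: nat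
  proof (induction j)
    case (Suc j)
    have "conj_by G (u [^] Suc j) v = conj_by G u (v [^] (a ^ j))"
      using u v Suc by (simp add: conj_by_comp)
    also have "\<dots> = (v [^] a) [^] (a ^ j)" using u v uv by (simp add: conj_by_pow)
    finally show ?case using v by (simp add: nat_pow_pow)
  qed (use v in simp)
  then have "v = v [^] (a ^ (p ^ k))" using u v by (metis conj_by_one)
  moreover have "[a ^ (p ^ j) = a] (mod p)" for j
  proof (induction j)
    case (Suc j)
    \<comment> \<open>This form of Fermat's theorem holds for every base. It is the one that fits,
      because \<open>v\<close> may be trivial and then \<open>a\<close> may be divisible by
      \<open>p\<close>.\<close>
    have fermat: "[b ^ p = b] (mod p)" for b
    proof (cases "p dvd b")
      case True
      then have "p dvd b ^ p" using dvd_power[of p b] prime_gt_0_nat[OF p] dvd_trans by blast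
      then show ?thesis using True by (simp add: cong_def)
    next
      case False
      then have "[b ^ (p - 1) * b = 1 * b] (mod p)" using fermat_theorem[OF p] cong_scalar_right by blast
      moreover have "b ^ (p - 1) * b = b ^ p" using p by (metis power_minus_mult prime_gt_0_nat)
      ultimately show ?thesis by simp
    qed
    have "a ^ (p ^ Suc j) = (a ^ (p ^ j)) ^ p" by (simp add: power_mult[symmetric] mult.commute)
    then show ?case using fermat[of "a ^ (p ^ j)"] Suc cong_trans by metis
  qed simp
  ultimately show ?thesis using pow_cong_exponent[OF v] uv by metis
qed

section \<open>The action of p-elements on cyclic chief factors\<close>

lemma r_coset_group_hom:
  assumes "M \<lhd> G" shows "group_hom G (G Mod M) (\<lambda>x. M #> x)"
  unfolding group_hom_def group_hom_axioms_def
  using assms normal.factorgroup_is_group normal.r_coset_hom_Mod is_group by blast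

lemma r_coset_eq_one_iff:
  assumes "subgroup M G" "x \<in> carrier G"
  shows "M #> x = M \<longleftrightarrow> x \<in> M"
  using assms coset_join1 coset_join2 subgroup.subset by blast

text \<open>The generator is moved from the quotient of \<open>H\<close> to \<open>G Mod M\<close>,
  because the elements that will act on it by conjugation lie outside \<open>H\<close>. Natural
  exponents fit the power computations there.\<close>

lemma cyclic_Mod_generator:
  assumes fin: "finite (carrier G)" and M: "M \<lhd> G" and H: "subgroup H G" "M \<subseteq> H"
    and cyc: "cyclic_group (G\<lparr>carrier := H\<rparr> Mod M)"
  obtains h where "h \<in> H" "\<And>y. y \<in> H \<Longrightarrow> \<exists>n::nat. M #> y = (M #> h) [^]\<^bsub>G Mod M\<^esub> n"
proof -
  interpret L: group "G\<lparr>carrier := H\<rparr>" using H by (simp add: subgroup_imp_group)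
  have normL: "M \<lhd> G\<lparr>carrier := H\<rparr>"
    using normal_Int_subgroup[OF H(1) M] H(2) by (simp add: Int_absorb2)
  interpret Q: group "G\<lparr>carrier := H\<rparr> Mod M" using normL by (rule normal.factorgroup_is_group)
  interpret \<psi>: group_hom G "G Mod M" "\<lambda>x. M #> x" using r_coset_group_hom[OF M] .
  have car: "carrier (G\<lparr>carrier := H\<rparr> Mod M) = (\<lambda>x. M #> x) ` H"
    by (auto simp: FactGroup_def RCOSETS_def r_coset_def)
  obtain X where X: "X \<in> carrier (G\<lparr>carrier := H\<rparr> Mod M)"
      "carrier (G\<lparr>carrier := H\<rparr> Mod M) = range (\<lambda>n::int. X [^]\<^bsub>G\<lparr>carrier := H\<rparr> Mod M\<^esub> n)"
    using cyc Q.cyclic_group by auto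
  obtain h where h: "h \<in> H" "X = M #> h" using X(1) car by auto
  have "finite (carrier (G\<lparr>carrier := H\<rparr> Mod M))"
    unfolding car using fin H finite_subset subgroup.subset by blast
  then have ord: "Q.ord X > 0" using X(1) Q.ord_ge_1 by (simp add: Suc_le_eq)
  have pow: "X [^]\<^bsub>G\<lparr>carrier := H\<rparr> Mod M\<^esub> (n::nat) = X [^]\<^bsub>G Mod M\<^esub> n" for n
    by (induction n) (simp_all add: FactGroup_def set_mult_def)
  show thesis
  proof (rule that[OF h(1)])
    fix y assume "y \<in> H"
    then obtain i :: int where i: "M #> y = X [^]\<^bsub>G\<lparr>carrier := H\<rparr> Mod M\<^esub> i" using X(2) car by blast
    \<comment> \<open>In a finite quotient an integer exponent may be replaced by its residue modulo
      the order of the generator.\<close>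
    define n where "n = nat (i mod int (Q.ord X))"
    have "int (Q.ord X) dvd int n - i"
      unfolding n_def using ord by (simp add: mod_eq_dvd_iff[symmetric])
    then have "M #> y = X [^]\<^bsub>G\<lparr>carrier := H\<rparr> Mod M\<^esub> (int n)"
      using i Q.int_pow_eq[OF X(1), of i "int n"] by simp
    then show "\<exists>n::nat. M #> y = (M #> h) [^]\<^bsub>G Mod M\<^esub> n"
      using pow h by (auto simp: int_pow_int)
  qed
qed

lemma subgroup_pow_card:
  assumes "subgroup H G" "x \<in> H"
  shows "x [^] card H = \<one>"
proof -
  interpret L: group "G\<lparr>carrier := H\<rparr>" using assms by (simp add: subgroup_imp_group)
  show ?thesis using L.pow_order_eq_1[of x] assms nat_pow_consistent[of x "card H" H] by (simp add: order_def)
qed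

lemma subgroup_nat_pow_closed:
  assumes "subgroup H G" "x \<in> H"
  shows "x [^] (n::nat) \<in> H"
  using assms by (induction n) (simp_all add: subgroup.one_closed subgroup.m_closed)

text \<open>As H/M is abelian, the elements whose \<open>p\<close>-th power lies in \<open>M\<close>
  form a normal subgroup. It is strictly larger than \<open>M\<close> because H/M is a nontrivial
  p-group, so it equals \<open>H\<close> by the chief factor property.\<close>

lemma cyclic_chief_factor_exponent:
  assumes fin: "finite (carrier G)" and p: "prime p" and chief: "chief_factor G H M"
    and cyc: "cyclic_group (G\<lparr>carrier := H\<rparr> Mod M)" and card: "card H = p ^ n" and y: "y \<in> H"
  shows "y [^] p \<in> M"
proof -
  have M: "M \<lhd> G" and H: "H \<lhd> G" and MH: "M \<subset> H" using chief unfolding chief_factor_def by auto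
  note s = M[THEN normal_imp_subgroup] H[THEN normal_imp_subgroup]
  interpret \<psi>: group_hom G "G Mod M" "\<lambda>x. M #> x" using r_coset_group_hom[OF M] .
  note ker = r_coset_eq_one_iff[OF s(1)]
  have Hc: "x \<in> carrier G" if "x \<in> H" for x using that s by (auto intro: subgroup.mem_carrier)
  obtain h where h: "h \<in> H" "\<And>y. y \<in> H \<Longrightarrow> \<exists>n::nat. M #> y = (M #> h) [^]\<^bsub>G Mod M\<^esub> n"
    using cyclic_Mod_generator[OF fin M s(2) _ cyc] MH by auto
  have hQ: "M #> h \<in> carrier (G Mod M)" using \<psi>.hom_closed Hc h(1) by blast
  have comm: "(M #> x) \<otimes>\<^bsub>G Mod M\<^esub> (M #> z) = (M #> z) \<otimes>\<^bsub>G Mod M\<^esub> (M #> x)"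
    if x: "x \<in> H" and z: "z \<in> H" for x z
  proof -
    obtain i j :: nat where "M #> x = (M #> h) [^]\<^bsub>G Mod M\<^esub> i" "M #> z = (M #> h) [^]\<^bsub>G Mod M\<^esub> j"
      using h(2) x z by meson
    then show ?thesis using \<psi>.H.nat_pow_comm[OF hQ] by metis
  qed
  have Mpow: "x [^] p \<in> M \<longleftrightarrow> (M #> x) [^]\<^bsub>G Mod M\<^esub> p = \<one>\<^bsub>G Mod M\<^esub>" if "x \<in> carrier G" for x
    using \<psi>.hom_nat_pow[OF that, of p] ker[of "x [^] p"] that by simp
  define L where "L = {x \<in> H. x [^] p \<in> M}"
  have "L \<lhd> G"
  proof (intro normal_conj_byI subgroupI)
    show "L \<subseteq> carrier G" using Hc L_def by auto
    show "L \<noteq> {}" using s by (auto simp: L_def intro!: exI[of _ \<one>] subgroup.one_closed)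
  next
    fix x assume x: "x \<in> L"
    then have "inv x [^] p = inv (x [^] p)" using Hc L_def by (simp add: nat_pow_inv)
    then show "inv x \<in> L" using x s by (simp add: L_def subgroup.m_inv_closed)
  next
    fix x z assume xz: "x \<in> L" "z \<in> L"
    then have c: "x \<in> carrier G" "z \<in> carrier G" using Hc L_def by auto
    have "(M #> (x \<otimes> z)) [^]\<^bsub>G Mod M\<^esub> p = (M #> x) [^]\<^bsub>G Mod M\<^esub> p \<otimes>\<^bsub>G Mod M\<^esub> (M #> z) [^]\<^bsub>G Mod M\<^esub> p"
      using \<psi>.H.pow_mult_distrib[OF comm] xz c \<psi>.hom_closed \<psi>.hom_mult L_def by simp
    moreover have "(M #> x) [^]\<^bsub>G Mod M\<^esub> p = \<one>\<^bsub>G Mod M\<^esub>" "(M #> z) [^]\<^bsub>G Mod M\<^esub> p = \<one>\<^bsub>G Mod M\<^esub>"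
      using xz Mpow[OF c(1)] Mpow[OF c(2)] unfolding L_def by blast+
    ultimately have "(M #> (x \<otimes> z)) [^]\<^bsub>G Mod M\<^esub> p = \<one>\<^bsub>G Mod M\<^esub>"
      using \<psi>.H.r_one[OF \<psi>.H.one_closed] by presburger
    then show "x \<otimes> z \<in> L" using xz Mpow[of "x \<otimes> z"] c s(2) unfolding L_def by (auto intro: subgroup.m_closed)
  next
    fix g x assume g: "g \<in> carrier G" and x: "x \<in> L"
    then have "conj_by G g x [^] p = conj_by G g (x [^] p)" using Hc L_def by (simp add: conj_by_pow)
    then show "conj_by G g x \<in> L" using x g conj_by_normal[OF M] conj_by_normal[OF H] L_def by auto
  qed
  moreover have "M \<subseteq> L" using MH subgroup_nat_pow_closed[OF s(1)] L_def by auto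
  moreover have "\<exists>z \<in> L. z \<notin> M"
  proof -
    obtain x where x: "x \<in> H" "x \<notin> M" using MH by auto
    \<comment> \<open>Minimality makes the power of \<open>x\<close> with exponent p^(j-1) an
      element outside \<open>M\<close> whose \<open>p\<close>-th power lies in \<open>M\<close>;
      \<open>j\<close> is positive since \<open>x\<close> is not in \<open>M\<close>.\<close>
    define j where "j = (LEAST j. x [^] (p ^ j) \<in> M)"
    have "x [^] (p ^ n) \<in> M" using subgroup_pow_card[OF s(2) x(1)] card s(1) by (simp add: subgroup.one_closed)
    then have j: "x [^] (p ^ j) \<in> M" unfolding j_def by (rule LeastI)
    have "j \<noteq> 0" using j x Hc by (metis nat_pow_eone power_0)
    then obtain i where i: "j = Suc i" using not0_implies_Suc by auto
    have "x [^] (p ^ i) \<notin> M" using not_less_Least[of i "\<lambda>j. x [^] (p ^ j) \<in> M"] i j_def by auto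
    moreover have "(x [^] (p ^ i)) [^] p \<in> M" using j i Hc[OF x(1)] by (simp add: nat_pow_pow mult.commute)
    ultimately show ?thesis using subgroup_nat_pow_closed[OF s(2) x(1)] L_def by blast
  qed
  moreover have "L \<subseteq> H" using L_def by auto
  ultimately have "L = H" using chief unfolding chief_factor_def by blast
  then show ?thesis using y L_def by auto
qed

text \<open>Normality of \<open>H\<close> makes the conjugate of a generator a power of that
  generator. As the generator has exponent \<open>p\<close> and the acting element has
  \<open>p\<close>-power order, the generator is fixed, and with it every power.\<close>

lemma cyclic_chief_factor_p_element:
  assumes fin: "finite (carrier G)" and p: "prime p" and chief: "chief_factor G H M"
    and cyc: "cyclic_group (G\<lparr>carrier := H\<rparr> Mod M)" and card: "card H = p ^ n"
    and x: "x \<in> carrier G" "x [^] (p ^ k) = \<one>" and y: "y \<in> H"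
  shows "M #> conj_by G x y = M #> y"
proof -
  have M: "M \<lhd> G" and H: "H \<lhd> G" and MH: "M \<subset> H" using chief unfolding chief_factor_def by auto
  note s = M[THEN normal_imp_subgroup] H[THEN normal_imp_subgroup]
  interpret \<psi>: group_hom G "G Mod M" "\<lambda>x. M #> x" using r_coset_group_hom[OF M] .
  have Hc: "x \<in> carrier G" if "x \<in> H" for x using that s by (auto intro: subgroup.mem_carrier)
  obtain h where h: "h \<in> H" "\<And>y. y \<in> H \<Longrightarrow> \<exists>n::nat. M #> y = (M #> h) [^]\<^bsub>G Mod M\<^esub> n"
    using cyclic_Mod_generator[OF fin M s(2) _ cyc] MH by auto
  have hom: "M #> conj_by G x z = conj_by (G Mod M) (M #> x) (M #> z)" if "z \<in> carrier G" for z
    using x(1) that unfolding conj_by_def by (simp only: \<psi>.hom_mult \<psi>.hom_inv inv_closed m_closed)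
  have Q: "M #> x \<in> carrier (G Mod M)" "M #> h \<in> carrier (G Mod M)"
    using \<psi>.hom_closed x(1) Hc h(1) by blast+
  have "(M #> x) [^]\<^bsub>G Mod M\<^esub> (p ^ k) = \<one>\<^bsub>G Mod M\<^esub>"
    using \<psi>.hom_nat_pow[OF x(1), of "p ^ k"] x(2) \<psi>.hom_one by simp
  moreover have "(M #> h) [^]\<^bsub>G Mod M\<^esub> p = \<one>\<^bsub>G Mod M\<^esub>"
    using \<psi>.hom_nat_pow[OF Hc[OF h(1)], of p] r_coset_eq_one_iff[OF s(1), of "h [^] p"] Hc[OF h(1)]
      cyclic_chief_factor_exponent[OF fin p chief cyc card h(1)] by simp
  moreover obtain a :: nat where "conj_by (G Mod M) (M #> x) (M #> h) = (M #> h) [^]\<^bsub>G Mod M\<^esub> a"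
    using h(2)[OF conj_by_normal[OF H x(1) h(1)]] hom[OF Hc[OF h(1)]] by auto
  ultimately have fixh: "conj_by (G Mod M) (M #> x) (M #> h) = M #> h"
    using \<psi>.H.conj_by_p_element_fixes[OF p] Q by blast
  obtain b :: nat where b: "M #> y = (M #> h) [^]\<^bsub>G Mod M\<^esub> b" using h(2) y by blast
  show ?thesis using hom[OF Hc[OF y]] \<psi>.H.conj_by_pow[OF Q, of b] fixh b by simp
qed


section \<open>The stability group and conjugacy under the centralizer\<close>

lemma pointwise_centralizer_mono:
  "P \<subseteq> Q \<Longrightarrow> pointwise_centralizer G Q \<subseteq> pointwise_centralizer G P"
  unfolding pointwise_centralizer_def by auto

lemma chief_factor_exists:
  assumes fin: "finite (carrier G)" and P: "P \<lhd> G" "P \<noteq> {\<one>}"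
  obtains M where "chief_factor G P M"
proof -
  define \<M> where "\<M> = {M. M \<lhd> G \<and> M \<subset> P}"
  note sP = normal_imp_subgroup[OF P(1)]
  have finP: "finite P" using fin sP finite_subset subgroup.subset by blast
  have "finite \<M>" by (rule finite_subset[of _ "Pow P"]) (use finP in \<open>auto simp: \<M>_def\<close>)
  moreover have "{\<one>} \<in> \<M>"
    using P(2) trivial_normal sP by (auto simp: \<M>_def subgroup.one_closed)
  ultimately obtain M where M: "M \<in> \<M>" "\<forall>L \<in> \<M>. M \<subseteq> L \<longrightarrow> L = M"
    using finite_has_maximal[of \<M>] by (metis empty_iff)
  then have "chief_factor G P M"
    using P(1) unfolding chief_factor_def \<M>_def by blast
  then show thesis using that by blast
qed

text \<open>The subgroup \<open>D\<close> consists of elements acting trivially on all factors of a chief series of \<open>G\<close>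
  below \<open>P\<close>; it acts on \<open>P\<close> as a \<open>p\<close>-group.\<close>

lemma supersolvably_embedded_stability_group:
  assumes fin: "finite (carrier G)" and p: "prime p"
  shows "supersolvably_embedded P \<Longrightarrow> card P = p ^ n \<Longrightarrow>
    \<exists>D. subgroup D G \<and> pointwise_centralizer G P \<subseteq> D \<and>
      (\<forall>x \<in> carrier G. \<forall>k::nat. x [^] (p ^ k) = \<one> \<longrightarrow> x \<in> D) \<and>
      (\<forall>x \<in> D. \<exists>k::nat. x [^] (p ^ k) \<in> pointwise_centralizer G P)"
proof (induction "card P" arbitrary: P n rule: less_induct)
  case less
  note embP = less.prems(1)
  have P: "P \<lhd> G" using embP supersolvably_embedded_normal by auto
  note sP = normal_imp_subgroup[OF P]
  have Pc: "x \<in> carrier G" if "x \<in> P" for x using sP that by (rule subgroup.mem_carrier)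
  show ?case
  proof (cases "P = {\<one>}")
    case True
    have "pointwise_centralizer G P = carrier G"
      unfolding pointwise_centralizer_def True conj_by_def by auto
    moreover have "x [^] (p ^ 0) \<in> carrier G" if "x \<in> carrier G" for x using that by simp
    ultimately show ?thesis using subgroup_self by (intro exI[of _ "carrier G"]) blast
  next
    case False
    obtain M where chief: "chief_factor G P M" using chief_factor_exists[OF fin P False] .
    then have nM: "M \<lhd> G" "M \<subset> P" unfolding chief_factor_def by auto
    note sM = normal_imp_subgroup[OF nM(1)]
    have finP: "finite P" using fin sP finite_subset subgroup.subset by blast
    have cyc: "cyclic_group (G\<lparr>carrier := P\<rparr> Mod M)"
      using embP chief unfolding supersolvably_embedded_def by blast
    obtain m where m: "card M = p ^ m" using p_subgroup_card[OF sM sP _ less.prems(2) p] nM by auto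
    have "card M < card P" using nM finP psubset_card_mono by auto
    moreover have "supersolvably_embedded M" using supersolvably_embedded_mono[OF embP] nM by auto
    ultimately obtain D where D: "subgroup D G" "pointwise_centralizer G M \<subseteq> D"
      "\<And>x k. x \<in> carrier G \<Longrightarrow> x [^] (p ^ k :: nat) = \<one> \<Longrightarrow> x \<in> D"
      "\<And>x. x \<in> D \<Longrightarrow> \<exists>k::nat. x [^] (p ^ k) \<in> pointwise_centralizer G M"
      using less.hyps[OF _ _ m] by blast
    \<comment> \<open>The kernel of the action on the top factor P/M; the required group is its
      intersection with the group \<open>D\<close> belonging to \<open>M\<close>.\<close>
    define E where "E = {x \<in> carrier G. \<forall>y \<in> P. M #> conj_by G x y = M #> y}"
    have sE: "subgroup E G"
    proof (intro subgroupI)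
      show "E \<noteq> {}" using Pc by (auto simp: E_def intro!: exI[of _ \<one>])
    next
      fix x assume x: "x \<in> E"
      then have xc: "x \<in> carrier G" unfolding E_def by auto
      have "M #> conj_by G (inv x) y = M #> y" if y: "y \<in> P" for y
      proof -
        have "conj_by G (inv x) y \<in> P" using conj_by_normal[OF P] xc y by auto
        then have "M #> conj_by G x (conj_by G (inv x) y) = M #> conj_by G (inv x) y"
          using x unfolding E_def by blast
        then show ?thesis using xc Pc[OF y] by simp
      qed
      then show "inv x \<in> E" using xc unfolding E_def by auto
    next
      fix x z assume xz: "x \<in> E" "z \<in> E"
      then have c: "x \<in> carrier G" "z \<in> carrier G" unfolding E_def by auto
      have "M #> conj_by G (x \<otimes> z) y = M #> y" if y: "y \<in> P" for y
      proof -
        have "conj_by G x y \<in> P" using conj_by_normal[OF P] c y by auto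
        then have "M #> conj_by G z (conj_by G x y) = M #> y"
          using xz y unfolding E_def by simp
        then show ?thesis using c Pc[OF y] by (simp add: conj_by_comp)
      qed
      then show "x \<otimes> z \<in> E" using c unfolding E_def by auto
    qed (auto simp: E_def)
    have "\<exists>k::nat. x [^] (p ^ k) \<in> pointwise_centralizer G P" if x: "x \<in> D" "x \<in> E" for x
    proof -
      obtain k :: nat where k: "x [^] (p ^ k) \<in> pointwise_centralizer G M" using D(4) x by blast
      define z where "z = x [^] (p ^ k)"
      have xc: "x \<in> carrier G" using x E_def by auto
      have z: "z \<in> E" "z \<in> carrier G" "\<And>y. y \<in> M \<Longrightarrow> conj_by G z y = y"
        using k subgroup_nat_pow_closed[OF sE x(2)] xc unfolding z_def pointwise_centralizer_def by auto
      \<comment> \<open>\<open>z\<close> acts trivially on \<open>M\<close> and on P/M, so it sends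
        y to q y with q in \<open>M\<close>. It also fixes q, hence its j-th power sends y to q^j y,
        and q^|M| = 1.\<close>
      have "conj_by G (z [^] card M) y = y" if y: "y \<in> P" for y
      proof -
        have yc: "y \<in> carrier G" using Pc y by auto
        have "M #> conj_by G z y = M #> y" using z(1) y unfolding E_def by auto
        moreover have "conj_by G z y \<in> M #> conj_by G z y" using rcos_self sM z(2) yc by auto
        ultimately obtain q where q: "q \<in> M" "conj_by G z y = q \<otimes> y"
          unfolding r_coset_def by auto
        have qc: "q \<in> carrier G" using q sM by (auto intro: subgroup.mem_carrier)
        have "conj_by G (z [^] j) y = q [^] j \<otimes> y" for j :: nat
        proof (induction j)
          case (Suc j)
          have "conj_by G (z [^] Suc j) y = conj_by G z (q [^] j \<otimes> y)"
            using z yc Suc by (simp add: conj_by_comp)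
          also have "\<dots> = q [^] j \<otimes> (q \<otimes> y)"
            using z(2) yc qc q(2) z(3)[OF subgroup_nat_pow_closed[OF sM q(1)]]
            by (simp add: conj_by_mult)
          finally show ?case using qc yc by (simp add: m_assoc)
        qed (use yc in simp)
        then show ?thesis using subgroup_pow_card[OF sM q(1)] yc by simp
      qed
      then have "z [^] card M \<in> pointwise_centralizer G P"
        using z(2) unfolding pointwise_centralizer_def by auto
      moreover have "z [^] card M = x [^] (p ^ (k + m))"
        using xc m by (simp add: z_def nat_pow_pow power_add)
      ultimately show ?thesis by metis
    qed
    moreover have "pointwise_centralizer G P \<subseteq> D \<inter> E"
    proof (rule Int_greatest)
      show "pointwise_centralizer G P \<subseteq> D"
        using D(2) pointwise_centralizer_mono[of M P] nM by blast
      show "pointwise_centralizer G P \<subseteq> E"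
        by (auto simp: pointwise_centralizer_def E_def)
    qed
    moreover have "x \<in> D \<inter> E" if "x \<in> carrier G" "x [^] (p ^ k) = \<one>" for x and k :: nat
      using D(3) that cyclic_chief_factor_p_element[OF fin p chief cyc less.prems(2)]
      unfolding E_def by blast
    moreover have "subgroup (D \<inter> E) G" using subgroups_Inter_pair D(1) sE by auto
    ultimately show ?thesis by (intro exI[of _ "D \<inter> E"]) blast
  qed
qed

text \<open>A prime divisor q other than \<open>p\<close> would give a nontrivial element of a Sylow
  q-subgroup whose order divides both a power of q and a power of \<open>p\<close>.\<close>

lemma order_prime_power:
  assumes fin: "finite (carrier G)" and p: "prime p"
    and exp: "\<And>x. x \<in> carrier G \<Longrightarrow> \<exists>k::nat. x [^] (p ^ k) = \<one>"
  obtains n where "order G = p ^ n"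
proof -
  have pos: "order G > 0" using fin order_gt_0_iff_finite by auto
  define r where "r = order G div p ^ multiplicity p (order G)"
  have r: "order G = p ^ multiplicity p (order G) * r"
    unfolding r_def by (simp add: multiplicity_dvd)
  have "\<not> p dvd r"
    unfolding r_def using pos p by (intro multiplicity_decompose) (auto simp: prime_nat_iff)
  have "r = 1"
  proof (rule ccontr)
    assume "r \<noteq> 1"
    then obtain q where q: "prime q" "q dvd r" using prime_factor_nat by blast
    then have qp: "q \<noteq> p" using \<open>\<not> p dvd r\<close> by auto
    obtain S where S: "sylow_subgroup q G S" using sylow_exists[OF fin q(1)] .
    have sS: "subgroup S G" "card S = q ^ multiplicity q (order G)"
      using S unfolding sylow_subgroup_def by auto
    have "q dvd order G" using q(2) r by (metis dvd_mult)
    then have "multiplicity q (order G) > 0" using q(1) pos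
      by (simp add: prime_multiplicity_gt_zero_iff)
    then have "card S > 1" using sS(2) one_less_power[OF prime_gt_1_nat[OF q(1)]] by simp
    then have "S \<noteq> {\<one>}" by auto
    then obtain x where x: "x \<in> S" "x \<noteq> \<one>" using subgroup.one_closed[OF sS(1)] by blast
    have xc: "x \<in> carrier G" using x sS by (auto intro: subgroup.mem_carrier)
    obtain k :: nat where "x [^] (p ^ k) = \<one>" using exp xc by blast
    then have "ord x dvd p ^ k" using pow_eq_id xc by blast
    moreover have "ord x dvd q ^ multiplicity q (order G)"
      using subgroup_pow_card[OF sS(1) x(1)] sS(2) pow_eq_id[OF xc] by simp
    moreover have "coprime (p ^ k) (q ^ multiplicity q (order G))"
      using p q(1) qp primes_coprime by auto
    ultimately have "ord x = 1" using coprime_common_divisor_nat by blast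
    then show False using x xc ord_eq_1 by auto
  qed
  then show thesis using that r by simp
qed

lemma lagrange_subgroup:
  assumes "subgroup A G" "subgroup B G" "A \<subseteq> B"
  shows "card (rcosets\<^bsub>G\<lparr>carrier := B\<rparr>\<^esub> A) * card A = card B"
proof -
  interpret B: group "G\<lparr>carrier := B\<rparr>" using assms by (simp add: subgroup_imp_group)
  show ?thesis using B.lagrange[OF subgroup_incl[OF assms]] by (simp add: order_def)
qed

text \<open>The stability group \<open>D\<close> of the previous lemma contains \<open>T\<close> and \<open>U\<close>. As \<open>D\<close> modulo the centralizer
  \<open>C\<close> of \<open>P\<close> is a \<open>p\<close>-group, \<open>D = C T\<close>.\<close>

lemma sylow_conj_by_centralizer:
  assumes fin: "finite (carrier G)" and p: "prime p"
    and emb: "supersolvably_embedded P" and cardP: "card P = p ^ n"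
    and T: "sylow_subgroup p G T" and U: "subgroup U G" "card U = p ^ k"
  obtains c where "c \<in> pointwise_centralizer G P" "conj_by G c ` U \<subseteq> T"
proof -
  define C where "C = pointwise_centralizer G P"
  have P: "P \<lhd> G" using emb supersolvably_embedded_normal by auto
  have nC: "C \<lhd> G" using pointwise_centralizer_normal[OF P] C_def by simp
  note sC = normal_imp_subgroup[OF nC]
  obtain D where D: "subgroup D G" "C \<subseteq> D"
      "\<And>x k. x \<in> carrier G \<Longrightarrow> x [^] (p ^ k :: nat) = \<one> \<Longrightarrow> x \<in> D"
      "\<And>x. x \<in> D \<Longrightarrow> \<exists>k::nat. x [^] (p ^ k) \<in> C"
    using supersolvably_embedded_stability_group[OF fin p emb cardP] unfolding C_def by blast
  have sT: "subgroup T G" "card T = p ^ multiplicity p (order G)"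
    using T unfolding sylow_subgroup_def by auto
  have sub: "V \<subseteq> D" if "subgroup V G" "card V = p ^ j" for V j
  proof
    fix x assume "x \<in> V"
    then show "x \<in> D"
      using D(3)[of x j] subgroup_pow_card[OF that(1)] subgroup.mem_carrier[OF that(1)] that(2) by simp
  qed
  note TD = sub[OF sT] and UD = sub[OF U]
  interpret L: group "G\<lparr>carrier := D\<rparr>" using D by (simp add: subgroup_imp_group)
  have finL: "finite (carrier (G\<lparr>carrier := D\<rparr>))"
    using finite_subset[OF subgroup.subset[OF D(1)] fin] by simp
  have CL: "C \<lhd> G\<lparr>carrier := D\<rparr>"
    using normal_Int_subgroup[OF D(1) nC] D(2) by (simp add: Int_absorb2)
  interpret Q: group "G\<lparr>carrier := D\<rparr> Mod C" using CL by (rule normal.factorgroup_is_group)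
  interpret \<psi>: group_hom "G\<lparr>carrier := D\<rparr>" "G\<lparr>carrier := D\<rparr> Mod C" "\<lambda>x. C #>\<^bsub>G\<lparr>carrier := D\<rparr>\<^esub> x"
    using L.r_coset_group_hom[OF CL] .
  have "\<exists>r. order (G\<lparr>carrier := D\<rparr> Mod C) = p ^ r"
  proof (rule Q.order_prime_power[OF _ p])
    show "finite (carrier (G\<lparr>carrier := D\<rparr> Mod C))"
      using finL by (auto simp: carrier_FactGroup)
  next
    fix X assume "X \<in> carrier (G\<lparr>carrier := D\<rparr> Mod C)"
    then have "X \<in> (\<lambda>x. C #>\<^bsub>G\<lparr>carrier := D\<rparr>\<^esub> x) ` D" unfolding carrier_FactGroup by simp
    then obtain x where x: "x \<in> D" "X = C #>\<^bsub>G\<lparr>carrier := D\<rparr>\<^esub> x" by blast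
    obtain k :: nat where k: "x [^] (p ^ k) \<in> C" using D(4) x by blast
    have "X [^]\<^bsub>G\<lparr>carrier := D\<rparr> Mod C\<^esub> (p ^ k) = C #>\<^bsub>G\<lparr>carrier := D\<rparr>\<^esub> (x [^] (p ^ k))"
      using \<psi>.hom_nat_pow[of x "p ^ k"] x nat_pow_consistent[of x "p ^ k" D] by simp
    also have "\<dots> = C"
      using L.r_coset_eq_one_iff[OF normal_imp_subgroup[OF CL]] k D(2) by auto
    finally show "\<exists>k::nat. X [^]\<^bsub>G\<lparr>carrier := D\<rparr> Mod C\<^esub> (p ^ k) = \<one>\<^bsub>G\<lparr>carrier := D\<rparr> Mod C\<^esub>" by auto
  qed blast
  then obtain r where r: "card (rcosets\<^bsub>G\<lparr>carrier := D\<rparr>\<^esub> C) = p ^ r"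
    by (auto simp: order_def FactGroup_def)
  have sCT: "subgroup (C <#> T) G" using mult_norm_subgroup[OF nC sT(1)] .
  have CTD: "C <#> T \<subseteq> D" using set_mult_subset[OF D(1)] D(2) TD by auto
  define i where "i = card (rcosets\<^bsub>G\<lparr>carrier := D\<rparr>\<^esub> (C <#> T))"
  have pos: "card V > 0" if "subgroup V G" for V
    using that fin subgroup.finite_imp_card_positive by blast
  have i: "i * card (C <#> T) = card D" using lagrange_subgroup[OF sCT D(1) CTD] i_def by simp
  have sub2: "C \<subseteq> C <#> T" "T \<subseteq> C <#> T" using subset_set_mult[OF sC sT(1)] by auto
  \<comment> \<open>The index \<open>i\<close> of CT in D divides the order of D/C, hence is a power
    of \<open>p\<close>.\<close>
  have "card (rcosets\<^bsub>G\<lparr>carrier := D\<rparr>\<^esub> C) = i * card (rcosets\<^bsub>G\<lparr>carrier := C <#> T\<rparr>\<^esub> C)"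
    using i lagrange_subgroup[OF sC sCT sub2(1)] lagrange_subgroup[OF sC D(1,2)] pos[OF sC]
    by (metis mult.assoc mult_cancel2 less_numeral_extra(3))
  then have "i dvd p ^ r" using r by (metis dvd_triv_left)
  then obtain j where j: "i = p ^ j" using p divides_primepow_nat by blast
  have indT: "card (rcosets T) = card (rcosets D) * card (rcosets\<^bsub>G\<lparr>carrier := D\<rparr>\<^esub> T)"
    using lagrange[OF sT(1)] lagrange[OF D(1)] lagrange_subgroup[OF sT(1) D(1) TD] pos[OF sT(1)]
    by (metis mult.assoc mult_cancel2 less_numeral_extra(3))
  have notp: "\<not> p dvd card (rcosets\<^bsub>G\<lparr>carrier := D\<rparr>\<^esub> T)"
    using sylow_index[OF fin p T] indT by (metis dvd_mult)
  \<comment> \<open>\<open>i\<close> also divides the index of T in D, which is prime to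
    \<open>p\<close>; so i = 1 and D = CT.\<close>
  have "card (rcosets\<^bsub>G\<lparr>carrier := D\<rparr>\<^esub> T) = i * card (rcosets\<^bsub>G\<lparr>carrier := C <#> T\<rparr>\<^esub> T)"
    using i lagrange_subgroup[OF sT(1) sCT sub2(2)] lagrange_subgroup[OF sT(1) D(1) TD] pos[OF sT(1)]
    by (metis mult.assoc mult_cancel2 less_numeral_extra(3))
  then have "j = 0" using notp j by (cases j) auto
  then have "card (C <#> T) = card D" using i j by simp
  then have DCT: "D = C <#> T" using card_subset_eq[OF _ CTD] finL by simp
  obtain d where d0: "d \<in> carrier (G\<lparr>carrier := D\<rparr>)"
    "\<And>u. u \<in> U \<Longrightarrow> inv\<^bsub>G\<lparr>carrier := D\<rparr>\<^esub> d \<otimes>\<^bsub>G\<lparr>carrier := D\<rparr>\<^esub> u \<otimes>\<^bsub>G\<lparr>carrier := D\<rparr>\<^esub> d \<in> T"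
    using L.p_subgroup_conj_into[OF finL subgroup_incl[OF sT(1) D(1) TD]
        subgroup_incl[OF U(1) D(1) UD] p U(2) notp] by blast
  have dD: "d \<in> D" using d0(1) by simp
  have d: "inv d \<otimes> u \<otimes> d \<in> T" if "u \<in> U" for u
    using d0(2)[OF that] m_inv_consistent[OF D(1) dD] by simp
  obtain c t where ct: "c \<in> C" "t \<in> T" "d = c \<otimes> t" using dD DCT unfolding set_mult_def by auto
  have c: "c \<in> carrier G" "t \<in> carrier G" using ct sC sT by (auto intro: subgroup.mem_carrier)
  have "conj_by G c u \<in> T" if u: "u \<in> U" for u
  proof -
    have uc: "u \<in> carrier G" using u U by (auto intro: subgroup.mem_carrier)
    \<comment> \<open>The element d = c t conjugates \<open>U\<close> into \<open>T\<close>; its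
      factor t lies in \<open>T\<close> and can be undone there, which leaves c.\<close>
    have "conj_by G t (conj_by G c u) \<in> T"
      using d[OF u] ct(3) c uc by (simp add: conj_by_comp[symmetric]) (simp add: conj_by_def)
    then have "conj_by G (inv t) (conj_by G t (conj_by G c u)) \<in> T"
      using conj_by_subgroup[OF sT(1)] ct sT(1) by (auto intro: subgroup.m_inv_closed)
    then show ?thesis using c uc by simp
  qed
  then show thesis using that ct(1) C_def by blast
qed

section \<open>Control of fusion\<close>


lemma conj_by_inj_on:
  assumes "g \<in> carrier G" "P \<subseteq> carrier G"
  shows "inj_on (conj_by G g) P"
  by (rule inj_on_inverseI[of _ "conj_by G (inv g)"]) (use assms in auto)

lemma card_conj_by_image:
  "g \<in> carrier G \<Longrightarrow> P \<subseteq> carrier G \<Longrightarrow> card (conj_by G g ` P) = card P"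
  using conj_by_inj_on by (rule card_image)

lemma conj_by_group_hom: "g \<in> carrier G \<Longrightarrow> group_hom G G (conj_by G g)"
  by unfold_locales (auto simp: hom_def conj_by_mult)

lemma subgroup_conj_by_image:
  "g \<in> carrier G \<Longrightarrow> subgroup P G \<Longrightarrow> subgroup (conj_by G g ` P) G"
  using group_hom.subgroup_img_is_subgroup[OF conj_by_group_hom] .

lemma conj_by_image_inv:
  assumes "g \<in> carrier G" "P \<subseteq> carrier G"
  shows "conj_by G (inv g) ` conj_by G g ` P = P" "conj_by G g ` conj_by G (inv g) ` P = P"
proof -
  have "conj_by G (inv g) (conj_by G g x) = x" "conj_by G g (conj_by G (inv g) x) = x" if "x \<in> P" for x
    using assms that by auto
  then show "conj_by G (inv g) ` conj_by G g ` P = P" "conj_by G g ` conj_by G (inv g) ` P = P"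
    unfolding image_image by simp_all
qed

lemma conj_by_image_comp:
  assumes "g \<in> carrier G" "h \<in> carrier G" "P \<subseteq> carrier G"
  shows "conj_by G (g \<otimes> h) ` P = conj_by G h ` conj_by G g ` P"
  unfolding image_image using assms by (intro image_cong refl) (auto simp: conj_by_comp)

text \<open>\<open>normalizer\<close> is a stabilizer for conjugation from the other side, by the
  inverse of g. Stabilizing \<open>P\<close> is invariant under inversion, which reconciles the two
  conventions.\<close>

lemma mem_normalizer_iff:
  assumes P: "subgroup P G"
  shows "g \<in> normalizer G P \<longleftrightarrow> g \<in> carrier G \<and> conj_by G g ` P = P"
proof (cases "g \<in> carrier G")
  case True
  have Pc: "P \<subseteq> carrier G" using P by (rule subgroup.subset)
  have "g <# P #> inv g = conj_by G (inv g) ` P"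
    using True unfolding l_coset_def r_coset_def conj_by_def by auto
  then have "g \<in> normalizer G P \<longleftrightarrow> conj_by G (inv g) ` P = P"
    unfolding normalizer_def stabilizer_def using True Pc by auto
  also have "\<dots> \<longleftrightarrow> conj_by G g ` P = P"
    using conj_by_image_inv[OF True Pc] by metis
  finally show ?thesis using True by simp
qed (simp add: normalizer_def stabilizer_def)

lemma subgroup_normalizer: "subgroup P G \<Longrightarrow> subgroup (normalizer G P) G"
  by (simp add: normalizer_imp_subgroup subgroup.subset)

lemma mem_normalizerI:
  assumes fin: "finite (carrier G)" and P: "subgroup P G" and g: "g \<in> carrier G"
    and im: "conj_by G g ` P \<subseteq> P"
  shows "g \<in> normalizer G P"
proof -
  have "finite P" using P fin finite_subset subgroup.subset by blast
  then have "conj_by G g ` P = P"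
    using im card_conj_by_image[OF g subgroup.subset[OF P]] by (simp add: card_subset_eq)
  then show ?thesis using mem_normalizer_iff[OF P] g by simp
qed

lemma subset_normalizer:
  assumes "subgroup P G" shows "P \<subseteq> normalizer G P"
proof
  fix x assume x: "x \<in> P"
  have xc: "x \<in> carrier G" using assms x by (rule subgroup.mem_carrier)
  have "conj_by G x ` P \<subseteq> P" "conj_by G (inv x) ` P \<subseteq> P"
    using conj_by_subgroup[OF assms] x assms by (auto simp: subgroup.m_inv_closed)
  then have "conj_by G x ` P = P"
    using conj_by_image_inv(2)[OF xc subgroup.subset[OF assms]] by (metis image_mono subset_antisym)
  then show "x \<in> normalizer G P" using xc mem_normalizer_iff[OF assms] by simp
qed

lemma conj_by_normalizer:
  assumes P: "subgroup P G" and g: "g \<in> carrier G" and x: "x \<in> normalizer G P"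
  shows "conj_by G g x \<in> normalizer G (conj_by G g ` P)"
proof -
  have Pc: "P \<subseteq> carrier G" using P by (rule subgroup.subset)
  have xc: "x \<in> carrier G" "conj_by G x ` P = P" using x mem_normalizer_iff[OF P] by auto
  have "conj_by G (conj_by G g x) ` conj_by G g ` P = conj_by G (g \<otimes> conj_by G g x) ` P"
    using conj_by_image_comp g xc Pc by simp
  also have "g \<otimes> conj_by G g x = x \<otimes> g"
    using g xc by (simp add: conj_by_def m_assoc inv_mult_cancel)
  also have "conj_by G (x \<otimes> g) ` P = conj_by G g ` P" using conj_by_image_comp g xc Pc by simp
  finally show ?thesis
    using mem_normalizer_iff[OF subgroup_conj_by_image[OF g P]] g xc by simp
qed

lemma normalizer_grows:
  assumes fin: "finite (carrier G)" and p: "prime p" and S: "subgroup S G" "card S = p ^ n"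
    and P: "subgroup P G" "P \<subset> S"
  shows "P \<subset> S \<inter> normalizer G P"
proof -
  interpret S: group "G\<lparr>carrier := S\<rparr>" using S by (simp add: subgroup_imp_group)
  have "finite (carrier (G\<lparr>carrier := S\<rparr>))"
    using finite_subset[OF subgroup.subset[OF S(1)] fin] by simp
  then obtain g where g: "g \<in> S" "g \<notin> P"
    "\<And>u. u \<in> P \<Longrightarrow> inv\<^bsub>G\<lparr>carrier := S\<rparr>\<^esub> g \<otimes>\<^bsub>G\<lparr>carrier := S\<rparr>\<^esub> u \<otimes>\<^bsub>G\<lparr>carrier := S\<rparr>\<^esub> g \<in> P"
    using S.proper_p_subgroup_normalized[OF _ subgroup_incl[OF P(1) S(1)] _ p, of n] P(2) S(2)
    by (auto simp: order_def)
  have "conj_by G g u \<in> P" if "u \<in> P" for u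
    using g(3)[OF that] m_inv_consistent[OF S(1) g(1)] by (simp add: conj_by_def)
  then have "g \<in> normalizer G P"
    using mem_normalizerI[OF fin P(1) subgroup.mem_carrier[OF S(1) g(1)]] by (simp add: image_subset_iff)
  then show ?thesis using g subset_normalizer[OF P(1)] P(2) by blast
qed

text \<open>A form of Alperin's fusion theorem without essential subgroups. By downward induction on \<open>P\<close>,
  the overgroups of \<open>P\<close> being treated already makes \<open>N\<^sub>S(P)\<close> a Sylow subgroup of \<open>N\<^sub>G(P)\<close>.\<close>

lemma sylow_normalizer_controls_fusion:
  assumes fin: "finite (carrier G)" and p: "prime p" and S: "sylow_subgroup p G S"
    and emb: "\<And>P. subgroup P G \<Longrightarrow> P \<subseteq> S \<Longrightarrow>
      sylow_subgroup p (G\<lparr>carrier := normalizer G P\<rparr>) (S \<inter> normalizer G P) \<Longrightarrow>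
      group.supersolvably_embedded (G\<lparr>carrier := normalizer G P\<rparr>) P"
  shows "subgroup P G \<Longrightarrow> P \<subseteq> S \<Longrightarrow> g \<in> carrier G \<Longrightarrow> conj_by G g ` P \<subseteq> S \<Longrightarrow>
    \<exists>n \<in> normalizer G S. \<forall>x \<in> P. conj_by G g x = conj_by G n x"
proof (induction "card S - card P" arbitrary: P g rule: less_induct)
  case less
  have sS: "subgroup S G" "card S = p ^ multiplicity p (order G)"
    using S unfolding sylow_subgroup_def by auto
  have finS: "finite S" using finite_subset[OF subgroup.subset[OF sS(1)] fin] .
  \<comment> \<open>The induction measure decreases as the subgroup grows, so the claim is available
    for every larger subgroup of \<open>S\<close>.\<close>
  have IH: "\<exists>n \<in> normalizer G S. \<forall>x \<in> Q. conj_by G h x = conj_by G n x"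
    if "subgroup Q G" "Q \<subseteq> S" "card P < card Q" "h \<in> carrier G" "conj_by G h ` Q \<subseteq> S" for Q h
    using that less.hyps[OF _ that(1,2,4,5)] card_mono[OF finS that(2)] by auto
  show ?case
  proof (cases "P = S")
    case True
    then have "g \<in> normalizer G S" using mem_normalizerI[OF fin sS(1)] less.prems by simp
    then show ?thesis by auto
  next
    case False
    have NS: "subgroup (S \<inter> normalizer G Q) G" if "subgroup Q G" for Q
      using subgroups_Inter_pair[OF sS(1) subgroup_normalizer[OF that]] .
    have grow: "card P < card (S \<inter> normalizer G Q)"
      if "subgroup Q G" "Q \<subset> S" "card Q = card P" for Q
      using normalizer_grows[OF fin p sS that(1,2)] that(3) psubset_card_mono finS by (metis finite_Int)
    \<comment> \<open>Proved for all proper subgroups of \<open>S\<close> of the order of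
      \<open>P\<close>, because it is needed for \<open>P\<close> and for its image under g.\<close>
    have fully: "sylow_subgroup p (G\<lparr>carrier := normalizer G Q\<rparr>) (S \<inter> normalizer G Q)"
      if Q: "subgroup Q G" "Q \<subset> S" "card Q = card P" for Q
    proof -
      let ?K = "G\<lparr>carrier := normalizer G Q\<rparr>"
      note sK = subgroup_normalizer[OF Q(1)]
      interpret K: group ?K using sK by (rule subgroup_imp_group)
      have finK: "finite (carrier ?K)" using finite_subset[OF subgroup.subset[OF sK] fin] by simp
      obtain V where V: "sylow_subgroup p ?K V" using K.sylow_exists[OF finK p] .
      have sV: "subgroup V ?K" "card V = p ^ multiplicity p (order ?K)"
        using V unfolding sylow_subgroup_def by auto
      have VG: "subgroup V G" using incl_subgroup[OF sK sV(1)] .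
      have VK: "V \<subseteq> normalizer G Q" using subgroup.subset[OF sV(1)] by simp
      note sN = NS[OF Q(1)]
      obtain a where a: "card (S \<inter> normalizer G Q) = p ^ a"
        using p_subgroup_card[OF sN sS(1) _ sS(2) p] by auto
      obtain k where k0: "k \<in> carrier ?K" "\<And>u. u \<in> S \<inter> normalizer G Q \<Longrightarrow> inv\<^bsub>?K\<^esub> k \<otimes>\<^bsub>?K\<^esub> u \<otimes>\<^bsub>?K\<^esub> k \<in> V"
        using K.p_subgroup_conj_into[OF finK sV(1) subgroup_incl[OF sN sK] p a K.sylow_index[OF finK p V]] by blast
      then have k: "k \<in> normalizer G Q" "k \<in> carrier G" using subgroup.mem_carrier[OF sK] by auto
      have kV: "conj_by G k u \<in> V" if "u \<in> S \<inter> normalizer G Q" for u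
        using k0(2)[OF that] m_inv_consistent[OF sK k(1)] by (simp add: conj_by_def)
      obtain h where h: "h \<in> carrier G" "\<And>u. u \<in> V \<Longrightarrow> inv h \<otimes> u \<otimes> h \<in> S"
        using p_subgroup_conj_into[OF fin sS(1) VG p sV(2) sylow_index[OF fin p S]] by blast
      have hS: "conj_by G h u \<in> S" if "u \<in> V" for u using h(2)[OF that] by (simp add: conj_by_def)
      have sub: "S \<inter> normalizer G Q \<subseteq> carrier G" using sN by (rule subgroup.subset)
      \<comment> \<open>k carries N_S(Q) into a Sylow subgroup \<open>V\<close> of N_G(Q), and h
        carries \<open>V\<close> into \<open>S\<close>. As N_S(Q) is larger than \<open>P\<close>,
        the induction hypothesis replaces k h on it by an element n of N_G(S).\<close>
      have "conj_by G (k \<otimes> h) ` (S \<inter> normalizer G Q) \<subseteq> S"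
        using conj_by_image_comp[OF k(2) h(1) sub] kV hS by auto
      then obtain n where n: "n \<in> normalizer G S"
        "\<forall>x \<in> S \<inter> normalizer G Q. conj_by G (k \<otimes> h) x = conj_by G n x"
        using IH[OF sN _ grow[OF Q], of "k \<otimes> h"] k h by auto
      have nc: "n \<in> carrier G" "conj_by G n ` S = S" using n(1) mem_normalizer_iff[OF sS(1)] by auto
      have Qc: "Q \<subseteq> carrier G" using Q(1) by (rule subgroup.subset)
      have "conj_by G (k \<otimes> h) ` Q = conj_by G n ` Q"
        using n(2) Q(2) subset_normalizer[OF Q(1)] by (intro image_cong) auto
      \<comment> \<open>k normalizes \<open>Q\<close>, so h and n have the same image of
        \<open>Q\<close>. Conjugation by h and then by the inverse of n thus moves \<open>V\<close>
        into \<open>S\<close> and into N_G(Q), which bounds |V| by |N_S(Q)|.\<close>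
      then have "conj_by G h ` Q = conj_by G n ` Q"
        using conj_by_image_comp[OF k(2) h(1) Qc] k(1) mem_normalizer_iff[OF Q(1)] by simp
      then have hV: "conj_by G h ` V \<subseteq> S \<inter> normalizer G (conj_by G n ` Q)"
        using conj_by_normalizer[OF Q(1) h(1)] VK hS by auto
      have "conj_by G (inv n) ` conj_by G h ` V \<subseteq> S \<inter> normalizer G Q"
      proof
        fix y assume "y \<in> conj_by G (inv n) ` conj_by G h ` V"
        then obtain z where z: "z \<in> S" "z \<in> normalizer G (conj_by G n ` Q)" "y = conj_by G (inv n) z"
          using hV by blast
        have "y \<in> conj_by G (inv n) ` conj_by G n ` S" using z(1,3) nc(2) by auto
        then have "y \<in> S" using conj_by_image_inv(1)[OF nc(1) subgroup.subset[OF sS(1)]] by simp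
        moreover have "y \<in> normalizer G (conj_by G (inv n) ` conj_by G n ` Q)"
          using conj_by_normalizer[OF subgroup_conj_by_image[OF nc(1) Q(1)] _ z(2)] z(3) nc(1) by simp
        ultimately show "y \<in> S \<inter> normalizer G Q"
          using conj_by_image_inv(1)[OF nc(1) Qc] by simp
      qed
      then have "card (conj_by G (inv n) ` conj_by G h ` V) \<le> card (S \<inter> normalizer G Q)"
        using finS by (intro card_mono) auto
      moreover have "card (conj_by G (inv n) ` conj_by G h ` V) = card V"
        using card_conj_by_image subgroup.subset[OF subgroup_conj_by_image[OF h(1) VG]]
          subgroup.subset[OF VG] h(1) nc(1) by simp
      moreover have "card (S \<inter> normalizer G Q) \<le> card V"
      proof -
        have "finite V" using finite_subset[OF subgroup.subset[OF VG] fin] .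
        then show ?thesis
          using card_conj_by_image[OF k(2) sub] kV by (metis card_mono image_subsetI)
      qed
      ultimately have "card (S \<inter> normalizer G Q) = card V" by simp
      then show ?thesis
        using sV(2) subgroup_incl[OF sN sK] unfolding sylow_subgroup_def by simp
    qed
    let ?K = "G\<lparr>carrier := normalizer G P\<rparr>"
    have P: "subgroup P G" "P \<subset> S" "card P = card P" using less.prems False by auto
    have g: "g \<in> carrier G" using less.prems by auto
    define P' where "P' = conj_by G g ` P"
    have Pc: "P \<subseteq> carrier G" using P(1) by (rule subgroup.subset)
    have P': "subgroup P' G" "P' \<subset> S" "card P' = card P"
    proof -
      show "subgroup P' G" using subgroup_conj_by_image[OF g P(1)] P'_def by simp
      show "card P' = card P" using card_conj_by_image[OF g Pc] P'_def by simp
      then show "P' \<subset> S" using less.prems(4) P'_def P(2) finS psubset_card_mono by (metis less_irrefl psubsetI)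
    qed
    define T where "T = S \<inter> normalizer G P"
    define T' where "T' = S \<inter> normalizer G P'"
    note sK = subgroup_normalizer[OF P(1)] and sK' = subgroup_normalizer[OF P'(1)]
    interpret K: group ?K using sK by (rule subgroup_imp_group)
    have finK: "finite (carrier ?K)" using finite_subset[OF subgroup.subset[OF sK] fin] by simp
    have sT: "subgroup T G" "subgroup T' G" using NS P P' T_def T'_def by auto
    note Tc = subgroup.subset[OF sT(1)] and T'c = subgroup.subset[OF sT(2)]
    have syl: "sylow_subgroup p ?K T" using fully[OF P] T_def by simp
    have syl': "sylow_subgroup p (G\<lparr>carrier := normalizer G P'\<rparr>) T'" using fully[OF P'] T'_def by simp
    have ginv: "inv g \<in> carrier G" using g by simp
    have PP': "conj_by G (inv g) ` P' = P" using conj_by_image_inv(1)[OF g Pc] P'_def by simp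
    have "conj_by G (inv g) ` normalizer G P' \<subseteq> normalizer G P"
      using conj_by_normalizer[OF P'(1) ginv] PP' by auto
    then have W: "conj_by G (inv g) ` T' \<subseteq> normalizer G P" using T'_def by auto
    have le: "conj_by G g ` normalizer G P \<subseteq> normalizer G P'"
      using conj_by_normalizer[OF P(1) g] P'_def by auto
    have "card (normalizer G P) = card (normalizer G P')"
    proof (rule antisym)
      have f: "finite (normalizer G P)" "finite (normalizer G P')"
        using fin sK sK' finite_subset subgroup.subset by blast+
      show "card (normalizer G P) \<le> card (normalizer G P')"
        using card_mono[OF f(2) le] card_conj_by_image[OF g subgroup.subset[OF sK]] by simp
      show "card (normalizer G P') \<le> card (normalizer G P)"
        using card_mono[OF f(1) \<open>conj_by G (inv g) ` normalizer G P' \<subseteq> normalizer G P\<close>]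
          card_conj_by_image[OF ginv subgroup.subset[OF sK']] by simp
    qed
    \<comment> \<open>Conjugation by the inverse of g identifies the two normalizers, so N_S(P') is
      carried to a second Sylow subgroup of N_G(P), to be compared with \<open>T\<close>.\<close>
    then have sylW: "sylow_subgroup p ?K (conj_by G (inv g) ` T')"
      using syl' subgroup_incl[OF subgroup_conj_by_image[OF ginv sT(2)] sK W]
        card_conj_by_image[OF ginv T'c]
      unfolding sylow_subgroup_def by (simp add: order_def)
    have embP: "K.supersolvably_embedded P" using emb[OF P(1)] P(2) syl T_def by auto
    obtain m where m: "card P = p ^ m" using p_subgroup_card[OF P(1) sS(1) _ sS(2) p] P(2) by auto
    have sTK: "subgroup T ?K" "card T = p ^ multiplicity p (order ?K)"
      using syl unfolding sylow_subgroup_def by auto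
    obtain c where c0: "c \<in> pointwise_centralizer ?K P" "conj_by ?K c ` T \<subseteq> conj_by G (inv g) ` T'"
      using K.sylow_conj_by_centralizer[OF finK p embP m sylW sTK] .
    have c: "c \<in> carrier G" "\<And>x. x \<in> P \<Longrightarrow> conj_by G c x = x"
      and cT: "conj_by G c ` T \<subseteq> conj_by G (inv g) ` T'"
      using c0 conj_by_consistent[OF sK] subgroup.mem_carrier[OF sK]
      unfolding pointwise_centralizer_def by auto
    \<comment> \<open>c g agrees with g on \<open>P\<close>, since c centralizes \<open>P\<close>,
      but it is a map from the larger subgroup \<open>T\<close> into \<open>S\<close>; the induction
      hypothesis applies to it.\<close>
    have "conj_by G (c \<otimes> g) ` T \<subseteq> conj_by G g ` conj_by G (inv g) ` T'"
      using conj_by_image_comp[OF c(1) g Tc] cT by auto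
    also have "\<dots> = T'" using conj_by_image_inv(2)[OF g T'c] .
    also have "\<dots> \<subseteq> S" using T'_def by auto
    finally obtain n where n: "n \<in> normalizer G S" "\<forall>x \<in> T. conj_by G (c \<otimes> g) x = conj_by G n x"
      using IH[OF sT(1) _ _ _ , of "c \<otimes> g"] grow[OF P] c(1) g T_def by auto
    have "conj_by G g x = conj_by G n x" if x: "x \<in> P" for x
    proof -
      have "x \<in> T" using x P(2) subset_normalizer[OF P(1)] T_def by auto
      then have "conj_by G (c \<otimes> g) x = conj_by G n x" using n(2) by auto
      then show ?thesis using c g x Pc by (auto simp: conj_by_comp)
    qed
    then show ?thesis using n(1) by auto
  qed
qed


section \<open>The normal series and the inheritance of the hypotheses\<close>

lemma supersolvably_embedded_chain:
  assumes fin: "finite (carrier G)"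
  shows "supersolvably_embedded P \<Longrightarrow>
    \<exists>(n::nat) T. T 0 = {\<one>} \<and> T n = P \<and> (\<forall>i\<le>n. T i \<lhd> G \<and> T i \<subseteq> P) \<and>
      (\<forall>i<n. T i \<subseteq> T (Suc i) \<and> cyclic_group (G\<lparr>carrier := T (Suc i)\<rparr> Mod T i))"
proof (induction "card P" arbitrary: P rule: less_induct)
  case less
  have P: "P \<lhd> G" using less.prems supersolvably_embedded_normal by auto
  show ?case
  proof (cases "P = {\<one>}")
    case True
    then show ?thesis using trivial_normal by (intro exI[of _ "0::nat"] exI[of _ "\<lambda>_. P"]) simp
  next
    case False
    obtain M where chief: "chief_factor G P M" using chief_factor_exists[OF fin P False] .
    then have M: "M \<lhd> G" "M \<subset> P" unfolding chief_factor_def by auto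
    have "finite P" using finite_subset[OF subgroup.subset[OF normal_imp_subgroup[OF P]] fin] .
    then have less_card: "card M < card P" using M psubset_card_mono by auto
    have embM: "supersolvably_embedded M" using supersolvably_embedded_mono[OF less.prems] M by auto
    obtain n :: nat and T where T: "T 0 = {\<one>}" "T n = M" "\<forall>i\<le>n. T i \<lhd> G \<and> T i \<subseteq> M"
      "\<forall>i<n. T i \<subseteq> T (Suc i) \<and> cyclic_group (G\<lparr>carrier := T (Suc i)\<rparr> Mod T i)"
      using less.hyps[OF less_card embM] by blast
    have cyc: "cyclic_group (G\<lparr>carrier := P\<rparr> Mod M)"
      using less.prems chief unfolding supersolvably_embedded_def by blast
    \<comment> \<open>The series of \<open>M\<close> is prolonged by \<open>P\<close>; its new top
      factor P/M is a chief factor and hence cyclic.\<close>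
    define T' where "T' = T(Suc n := P)"
    have "T' i \<lhd> G \<and> T' i \<subseteq> P" if "i \<le> Suc n" for i
    proof (cases "i = Suc n")
      case False
      then have "i \<le> n" using that by simp
      then show ?thesis using T(3) M(2) False unfolding T'_def by auto
    qed (simp add: T'_def P)
    moreover have "T' i \<subseteq> T' (Suc i) \<and> cyclic_group (G\<lparr>carrier := T' (Suc i)\<rparr> Mod T' i)" if "i < Suc n" for i
    proof (cases "i = n")
      case False
      then show ?thesis using T(4) that unfolding T'_def by simp
    qed (use T(2) M(2) cyc in \<open>auto simp: T'_def\<close>)
    ultimately show ?thesis
      using T(1) by (intro exI[of _ "Suc n"] exI[of _ T']) (simp add: T'_def)
  qed
qed

text \<open>\<open>sylow_subgroup\<close> depends on the order of the ambient group. |S| divides |K|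
  and |K| divides |G|, so the multiplicities of \<open>p\<close> in |K| and |G| agree.\<close>

lemma sylow_subgroup_intermediate:
  assumes fin: "finite (carrier G)" and p: "prime p" and S: "sylow_subgroup p G S"
    and K: "subgroup K G" "S \<subseteq> K"
  shows "sylow_subgroup p (G\<lparr>carrier := K\<rparr>) S"
proof -
  have sS: "subgroup S G" "card S = p ^ multiplicity p (order G)"
    using S unfolding sylow_subgroup_def by auto
  have "card K dvd order G" using lagrange[OF K(1)] by (metis dvd_triv_right)
  moreover have "order G \<noteq> 0" using fin order_gt_0_iff_finite by auto
  ultimately have le: "multiplicity p (card K) \<le> multiplicity p (order G)"
    by (intro dvd_imp_multiplicity_le) auto
  have "p ^ multiplicity p (order G) dvd card K"
    using lagrange_subgroup[OF sS(1) K] sS(2) by (metis dvd_triv_right)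
  moreover have "card K \<noteq> 0" using subgroup.finite_imp_card_positive[OF K(1) fin] by simp
  moreover have "\<not> is_unit p" using p by (simp add: prime_nat_iff)
  ultimately have "multiplicity p (order G) \<le> multiplicity p (card K)"
    by (intro multiplicity_geI)
  then show ?thesis
    using le sS subgroup_incl[OF sS(1) K] unfolding sylow_subgroup_def by (simp add: order_def)
qed

lemma comm_group_subgroup_mono:
  assumes A: "subgroup A G" and B: "A \<subseteq> B" "comm_group (G\<lparr>carrier := B\<rparr>)"
  shows "comm_group (G\<lparr>carrier := A\<rparr>)"
proof -
  interpret B: comm_group "G\<lparr>carrier := B\<rparr>" by (rule B(2))
  show ?thesis
    by (rule group.group_comm_groupI[OF subgroup_imp_group[OF A]])
      (use B(1) B.m_comm in auto)
qed

end

text \<open>The bridge from the abstract relation to chief factors: (0) carries \<open>R\<close>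
  from \<open>G\<close> down to \<open>K\<close>, and (1') is then applied in \<open>K\<close>. It
  serves for K = N_G(P) and T = N_S(P).\<close>

lemma semi_1_eternal_supersolvably_embedded:
  fixes R :: "'a set \<Rightarrow> 'a monoid \<Rightarrow> bool" and G :: "'a monoid"
  assumes R: "semi_1_eternal R" and "group G" and fin: "finite (carrier G)" and p: "prime p"
    and min: "\<And>H. subgroup H G \<Longrightarrow> H \<subseteq> S \<Longrightarrow> card H = p \<Longrightarrow> R H G"
    and four: "\<And>H. \<not> comm_group (G\<lparr>carrier := S\<rparr>) \<Longrightarrow> p = 2 \<Longrightarrow> subgroup H G \<Longrightarrow> H \<subseteq> S \<Longrightarrow>
           cyclic_group (G\<lparr>carrier := H\<rparr>) \<Longrightarrow> card H = 4 \<Longrightarrow> R H G"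
    and K: "subgroup K G" and T: "sylow_subgroup p (G\<lparr>carrier := K\<rparr>) T" "T \<subseteq> S"
    and P: "P \<lhd> G\<lparr>carrier := K\<rparr>" "card P = p ^ n"
  shows "group.supersolvably_embedded (G\<lparr>carrier := K\<rparr>) P"
proof -
  let ?K = "G\<lparr>carrier := K\<rparr>"
  interpret group G by fact
  interpret K: group ?K using K by (rule subgroup_imp_group)
  have finK: "finite (carrier ?K)" using finite_subset[OF subgroup.subset[OF K] fin] by simp
  show ?thesis
  proof (cases "P = {\<one>\<^bsub>G\<^esub>}")
    case True
    then show ?thesis using K.supersolvably_embedded_trivial by simp
  next
    case False
    have sP: "subgroup P ?K" using P(1) by (rule normal_imp_subgroup)
    have "n \<noteq> 0"
    proof
      assume "n = 0"
      then have "card P = 1" using P(2) by simp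
      then show False using False subgroup.one_closed[OF sP] by (auto simp: card_1_singleton_iff)
    qed
    then have "p dvd card P" using P(2) by (simp add: dvd_power)
    \<comment> \<open>(1') is available only for prime divisors of the order of \<open>K\<close>;
      nontriviality of \<open>P\<close> provides this, which explains the case distinction.\<close>
    then have dvd: "p dvd order ?K" using K.lagrange[OF sP] by (metis dvd_mult)
    let ?C = "p_core p ?K"
    note nC = K.p_core_normal[OF finK p]
    have sC: "subgroup ?C G" using incl_subgroup[OF K normal_imp_subgroup[OF nC]] .
    have CS: "?C \<subseteq> S"
      using K.p_core_card[OF finK p] K.normal_p_subgroup_subset_sylow[OF finK p T(1) nC] T(2) by blast
    have restr: "R H ?K" if "subgroup H ?K" "R H G" for H
    proof -
      have "subgroup H G" "H \<subseteq> K"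
        using incl_subgroup[OF K that(1)] subgroup.subset[OF that(1)] by simp_all
      then show ?thesis using R that(2) K fin \<open>group G\<close> unfolding semi_1_eternal_def by blast
    qed
    have order: "\<forall>H. subgroup H ?K \<and> H \<subseteq> ?C \<and> card H = p \<longrightarrow> R H ?K"
    proof (intro allI impI)
      fix H assume H: "subgroup H ?K \<and> H \<subseteq> ?C \<and> card H = p"
      then have "R H G" using min[of H] incl_subgroup[OF K, of H] CS by blast
      then show "R H ?K" using restr H by blast
    qed
    have "\<not> comm_group (?K\<lparr>carrier := ?C\<rparr>) \<and> p = 2 \<longrightarrow>
      (\<forall>H. subgroup H ?K \<and> H \<subseteq> ?C \<and> cyclic_group (?K\<lparr>carrier := H\<rparr>) \<and> card H = 4 \<longrightarrow> R H ?K)"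
    proof (intro allI impI)
      fix H assume nonab: "\<not> comm_group (?K\<lparr>carrier := ?C\<rparr>) \<and> p = 2"
        and H: "subgroup H ?K \<and> H \<subseteq> ?C \<and> cyclic_group (?K\<lparr>carrier := H\<rparr>) \<and> card H = 4"
      \<comment> \<open>A non-abelian O_p(K) inside \<open>S\<close> forces \<open>S\<close> to be
        non-abelian, so the hypothesis on cyclic subgroups of order 4 is in force whenever (1') asks
        for it.\<close>
      have "\<not> comm_group (G\<lparr>carrier := S\<rparr>)"
        using nonab comm_group_subgroup_mono[OF sC CS] by auto
      moreover have "subgroup H G" "H \<subseteq> S" using H incl_subgroup[OF K, of H] CS by blast+
      ultimately have "R H G" using four[of H] nonab H by simp
      then show "R H ?K" using restr H by blast
    qed
    then have "?C \<subseteq> supersolvable_hypercenter ?K"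
      using R K.is_group finK p dvd order unfolding semi_1_eternal_def by blast
    moreover have "P \<subseteq> ?C" using K.p_core_greatest[OF finK p P] .
    ultimately show ?thesis
      using K.supersolvably_embedded_mono[OF K.supersolvably_embedded_hypercenter[OF finK] P(1)] by blast
  qed
qed

theorem theorem3p19:
  fixes R :: "'a set \<Rightarrow> 'a monoid \<Rightarrow> bool"
    and G :: "'a monoid"
    and p :: nat
    and S :: "'a set"
  assumes "semi_1_eternal R"
    and "group G" and "finite (carrier G)"
    and "prime p" and "p dvd order G"
    and "sylow_subgroup p G S"
    and "\<And>H. subgroup H G \<Longrightarrow> H \<subseteq> S \<Longrightarrow> card H = p \<Longrightarrow> R H G"
    and "\<And>H. \<not> comm_group (G\<lparr>carrier := S\<rparr>) \<Longrightarrow> p = 2 \<Longrightarrow> subgroup H G \<Longrightarrow> H \<subseteq> S \<Longrightarrow>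
           cyclic_group (G\<lparr>carrier := H\<rparr>) \<Longrightarrow> card H = 4 \<Longrightarrow> R H G"
  shows "supersolvable_fusion (G\<lparr>carrier := S\<rparr>) (group_fusion G S)"
proof -
  interpret group G by fact
  note fin = assms(3) and p = assms(4)
  have sS: "subgroup S G" "card S = p ^ multiplicity p (order G)"
    using assms(6) unfolding sylow_subgroup_def by auto
  have emb: "group.supersolvably_embedded (G\<lparr>carrier := normalizer G P\<rparr>) P"
    if P: "subgroup P G" "P \<subseteq> S"
      and syl: "sylow_subgroup p (G\<lparr>carrier := normalizer G P\<rparr>) (S \<inter> normalizer G P)" for P
  proof -
    obtain m where "card P = p ^ m" using p_subgroup_card[OF P(1) sS(1) P(2) sS(2) p] .
    then show ?thesis
      using semi_1_eternal_supersolvably_embedded[OF assms(1-4,7,8) subgroup_normalizer[OF P(1)] syl _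
          subgroup_in_normalizer[OF P(1)]] by blast
  qed
  let ?K = "G\<lparr>carrier := normalizer G S\<rparr>"
  note sK = subgroup_normalizer[OF sS(1)] and SK = subset_normalizer[OF sS(1)]
  interpret K: group ?K using sK by (rule subgroup_imp_group)
  have finK: "finite (carrier ?K)" using finite_subset[OF subgroup.subset[OF sK] fin] by simp
  have "S \<inter> normalizer G S = S" using SK by blast
  then have embS: "K.supersolvably_embedded S"
    using emb[OF sS(1) subset_refl] sylow_subgroup_intermediate[OF fin p assms(6) sK SK] by argo
  obtain n :: nat and T where T: "T 0 = {\<one>\<^bsub>?K\<^esub>}" "T n = S" "\<forall>i\<le>n. T i \<lhd> ?K \<and> T i \<subseteq> S"
    "\<forall>i<n. T i \<subseteq> T (Suc i) \<and> cyclic_group (?K\<lparr>carrier := T (Suc i)\<rparr> Mod T i)"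
    using K.supersolvably_embedded_chain[OF finK embS] by blast
  have "strongly_closed (G\<lparr>carrier := S\<rparr>) (group_fusion G S) (T i)" if i: "i \<le> n" for i
    unfolding strongly_closed_def
  proof (intro conjI allI impI)
    have Ti: "T i \<lhd> ?K" "T i \<subseteq> S" using T(3) i by auto
    show "subgroup (T i) (G\<lparr>carrier := S\<rparr>)"
      using subgroup_incl[OF incl_subgroup[OF sK normal_imp_subgroup[OF Ti(1)]] sS(1) Ti(2)] .
  next
    fix P \<phi>
    assume "subgroup P (G\<lparr>carrier := S\<rparr>) \<and> P \<subseteq> T i \<and>
      \<phi> \<in> group_fusion G S P (carrier (G\<lparr>carrier := S\<rparr>))"
    then obtain g where P: "subgroup P (G\<lparr>carrier := S\<rparr>)" "P \<subseteq> T i" and g: "g \<in> carrier G"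
      "\<phi> = restrict (conj_by G g) P" "conj_by G g ` P \<subseteq> S"
      unfolding group_fusion_def conj_by_def[abs_def] by auto
    have sP: "subgroup P G" "P \<subseteq> S"
      using incl_subgroup[OF sS(1) P(1)] subgroup.subset[OF P(1)] by simp_all
    obtain m where m: "m \<in> normalizer G S" "\<forall>x \<in> P. conj_by G g x = conj_by G m x"
      using sylow_normalizer_controls_fusion[OF fin p assms(6) emb sP g(1,3)] by blast
    \<comment> \<open>\<open>m\<close> normalizes \<open>S\<close> and T_i is normal in N_G(S);
      control of fusion thus turns normality there into strong closure.\<close>
    have "conj_by G m x \<in> T i" if "x \<in> P" for x
      using K.conj_by_normal[of "T i" m x] T(3) i m(1) that P(2) conj_by_consistent[OF sK m(1)] by auto
    then show "\<phi> ` P \<subseteq> T i" using g(2) m(2) by auto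
  qed
  \<comment> \<open>Overwriting a carrier forgets the previous one, so the quotients formed inside
    N_G(S) are literally those formed inside \<open>S\<close>.\<close>
  then show ?thesis
    unfolding supersolvable_fusion_def using T by (intro exI[of _ n] exI[of _ T]) simp
qed

end
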